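(* Let $r\ge2$ be an integer and let $$\mathscr{H}^r=\{h\in C^r([0,1]^2;\mathbb{R}): D_2D_1h<0\},$$ equipped with the $C^r$-norm. Then: (i) There is a $C^r$ open dense subset $\mathscr{O}$ of $\mathscr{H}^r$ such that for each $h\in\mathscr{O}$ the Mather set and the Aubry set of (the potential $\underline{x}\mapsto h(x_0,x_1)$ on $X$ determined by) $h$ consist of a single fixed point of $\sigma$. (ii) For arbitrary $h\in\mathscr{H}^r$ there is a $C^r$ open dense subset $\mathscr{V}_h$ of $C^r([0,1];\mathbb{R})$ such that for each $V\in\mathscr{V}_h$ the Mather set and the Aubry set of $h+V$, i.e. of the potential $\underline{x}\mapsto h(x_0,x_1)+V(x_0)$ on $X$, consist of a single fixed point of $\sigma$.
   Context: $\mathbb{N}_0$ is the set of non-negative integers and $X=[0,1]^{\mathbb{N}_0}$ with metric $d(\underline{x},\underline{y})=\sum_{i\ge 0}|x_i-y_i|/2^i$; $\sigma:X\to X$ is the left shift, $(\sigma(\underline{x}))_i=x_{i+1}$ (the dynamical system $(X,\sigma)$ is the XY model). $D_i$ denotes the partial derivative in the $i$-th variable. The $C^r$-norm on $C^r([0,1]^2;\mathbb{R})$ is $\|h\|_{C^r}=\sum_{|\beta|\le r}\sup_{[0,1]^2}|\partial^\beta h|$, and similarly on $C^r([0,1];\mathbb{R})$. For continuous $\varphi:X\to\mathbb{R}$, $\alpha_\varphi=\inf_\mu\int\varphi\,d\mu$ over all $\sigma$-invariant Borel probability measures $\mu$ on $X$; $\mathcal{M}_{\min}(\varphi)$ is the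 set of such $\mu$ with $\int\varphi\,d\mu=\alpha_\varphi$. The Mather set of $\varphi$ is $\mathscr{M}_\varphi=\bigcup_{\mu\in\mathcal{M}_{\min}(\varphi)}\mathrm{supp}(\mu)$. For $\psi:X\to\mathbb{R}$ and $n\in\mathbb{N}=\{1,2,\dots\}$, $S_n\psi=\sum_{i=0}^{n-1}\psi\circ\sigma^i$. With $B(\underline{x},\underline{y},n;\varepsilon)=\{\underline{z}\in X: d(\underline{x},\underline{z})<\varepsilon,\ d(\sigma^n(\underline{z}),\underline{y})<\varepsilon\}$, the Mañé potential is $S_\varphi(\underline{x},\underline{y})=\lim_{\varepsilon\to0}\inf\{S_n(\varphi-\alpha_\varphi)(\underline{z}): n\in\mathbb{N},\ \underline{z}\in B(\underline{x},\underline{y},n;\varepsilon)\}$, and the Aubry set of $\varphi$ is $\Omega_\varphi=\{\underline{x}\in X: S_\varphi(\underline{x},\underline{x})=0\}$. *)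

theory Defs
  imports "HOL-Probability.Probability"
begin

section \<open>The XY model\<close>

definition xy_space :: "(nat \<Rightarrow> real) set" where
  "xy_space = {x. \<forall>i. x i \<in> {0..1}}"

definition xy_dist :: "(nat \<Rightarrow> real) \<Rightarrow> (nat \<Rightarrow> real) \<Rightarrow> real" where
  "xy_dist x y = (\<Sum>i. \<bar>x i - y i\<bar> / 2 ^ i)"

definition left_shift :: "(nat \<Rightarrow> real) \<Rightarrow> nat \<Rightarrow> real" where
  "left_shift x = (\<lambda>i. x (Suc i))"

lemma xy_coord_bound:
  assumes "x \<in> xy_space" "y \<in> xy_space"
  shows "norm (\<bar>x i - y i\<bar> / 2 ^ i) \<le> (1/2) ^ i"
proof -
  have "x i \<in> {0..1}" "y i \<in> {0..1}"
    using assms by (simp_all add: xy_space_def)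
  then have "\<bar>x i - y i\<bar> \<le> 1"
    by auto
  then show ?thesis
    by (simp add: power_one_over divide_right_mono)
qed

lemma xy_dist_coord:
  assumes "x \<in> xy_space" "y \<in> xy_space"
  shows "\<bar>x i - y i\<bar> \<le> 2 ^ i * xy_dist x y"
proof -
  have "summable (\<lambda>i. \<bar>x i - y i\<bar> / 2 ^ i)"
    by (rule summable_comparison_test'[where g = "\<lambda>i. (1/2) ^ i" and N = 0])
       (use xy_coord_bound[OF assms] in \<open>auto intro: summable_geometric\<close>)
  then have "(\<Sum>j\<in>{i}. \<bar>x j - y j\<bar> / 2 ^ j) \<le> xy_dist x y"
    unfolding xy_dist_def by (rule sum_le_suminf) auto
  then show ?thesis
    by (simp add: field_simps)
qed

text \<open>
  The metric induces on \<^const>\<open>xy_space\<close> the product topology, that is, the subspace topology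
  inherited from the library topology on \<^typ>\<open>nat \<Rightarrow> real\<close>. Borel sets and supports below
  refer to the latter.
\<close>

lemma openin_xy_space_iff:
  "openin (top_of_set xy_space) U \<longleftrightarrow>
     U \<subseteq> xy_space \<and> (\<forall>x\<in>U. \<exists>\<epsilon>>0. \<forall>y\<in>xy_space. xy_dist x y < \<epsilon> \<longrightarrow> y \<in> U)" (is "?L \<longleftrightarrow> ?R")
proof
  assume L: ?L
  then obtain T where T: "open T" "U = xy_space \<inter> T"
    by (auto simp: openin_open)
  have "\<exists>\<epsilon>>0. \<forall>y\<in>xy_space. xy_dist x y < \<epsilon> \<longrightarrow> y \<in> U" if x: "x \<in> U" for x
  proof (rule ccontr)
    assume "\<not> ?thesis"
    then have "\<exists>y\<in>xy_space. xy_dist x y < 1 / real (Suc n) \<and> y \<notin> U" for n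
      by (metis of_nat_0_less_iff zero_less_Suc zero_less_divide_1_iff)
    then obtain y where y: "\<And>n. y n \<in> xy_space" "\<And>n. xy_dist x (y n) < 1 / real (Suc n)"
        "\<And>n. y n \<notin> U"
      by metis
    have xX: "x \<in> xy_space" and xT: "x \<in> T" using x T by auto
    have "(\<lambda>n. y n i) \<longlonglongrightarrow> x i" for i
    proof (rule Lim_transform_bound[where g = "\<lambda>n. 2 ^ i * (1 / real (Suc n))", THEN LIM_zero_cancel])
      show "\<forall>\<^sub>F n in sequentially. norm (y n i - x i) \<le> norm (2 ^ i * (1 / real (Suc n)))"
      proof (rule always_eventually, rule allI)
        fix n
        have "\<bar>x i - y n i\<bar> \<le> 2 ^ i * xy_dist x (y n)"
          by (rule xy_dist_coord[OF xX y(1)])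
        also have "\<dots> \<le> 2 ^ i * (1 / real (Suc n))"
          using y(2)[of n] by (intro mult_left_mono) auto
        finally show "norm (y n i - x i) \<le> norm (2 ^ i * (1 / real (Suc n)))"
          by (simp add: abs_minus_commute)
      qed
      show "(\<lambda>n. 2 ^ i * (1 / real (Suc n))) \<longlonglongrightarrow> 0"
        using tendsto_mult_right_zero[OF LIMSEQ_inverse_real_of_nat, of "2 ^ i"]
        by (simp add: inverse_eq_divide)
    qed
    then have "y \<longlonglongrightarrow> x"
      using limitin_componentwise[of "\<lambda>_. euclidean" UNIV y x sequentially]
      by (simp add: euclidean_product_topology)
    then have "\<forall>\<^sub>F n in sequentially. y n \<in> T"
      using T(1) xT by (rule topological_tendstoD)
    then show False
      using y T by (auto simp: eventually_sequentially)
  qed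
  then show ?R using T by blast
next
  assume R: ?R
  have cont: "continuous_on xy_space (xy_dist x)" if x: "x \<in> xy_space" for x
  proof -
    have "uniform_limit xy_space (\<lambda>n y. \<Sum>i<n. \<bar>x i - y i\<bar> / 2 ^ i) (xy_dist x) sequentially"
      unfolding xy_dist_def
      by (rule Weierstrass_m_test[where M = "\<lambda>i. (1/2) ^ i"])
         (use xy_coord_bound x in \<open>auto intro: summable_geometric\<close>)
    then show ?thesis
      by (rule uniform_limit_theorem[rotated])
         (auto intro!: always_eventually continuous_intros
            continuous_on_subset[OF continuous_on_product_coordinates])
  qed
  show ?L
  proof (subst openin_subopen, intro ballI)
    fix x assume x: "x \<in> U"
    then obtain \<epsilon> where \<epsilon>: "\<epsilon> > 0" "\<forall>y\<in>xy_space. xy_dist x y < \<epsilon> \<longrightarrow> y \<in> U"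
      using R by blast
    have "openin (top_of_set xy_space) (xy_space \<inter> xy_dist x -` {..<\<epsilon>})"
      by (rule continuous_openin_preimage_gen) (use cont x R in auto)
    moreover have "x \<in> xy_space \<inter> xy_dist x -` {..<\<epsilon>}"
      using x R \<epsilon> by (auto simp: xy_dist_def)
    ultimately show "\<exists>T. openin (top_of_set xy_space) T \<and> x \<in> T \<and> T \<subseteq> U"
      using \<epsilon> by blast
  qed
qed

definition invariant_measures :: "(nat \<Rightarrow> real) measure set" where
  "invariant_measures =
     {\<mu>. prob_space \<mu> \<and> sets \<mu> = sets (restrict_space borel xy_space) \<and> distr \<mu> \<mu> left_shift = \<mu>}"

definition measure_support :: "(nat \<Rightarrow> real) measure \<Rightarrow> (nat \<Rightarrow> real) set" where
  "measure_support \<mu> =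
     {x\<in>xy_space. \<forall>U. openin (top_of_set xy_space) U \<and> x \<in> U \<longrightarrow> emeasure \<mu> U > 0}"

definition min_average :: "((nat \<Rightarrow> real) \<Rightarrow> real) \<Rightarrow> real" where
  "min_average \<phi> = (INF \<mu>\<in>invariant_measures. \<integral>x. \<phi> x \<partial>\<mu>)"

definition minimizing_measures :: "((nat \<Rightarrow> real) \<Rightarrow> real) \<Rightarrow> (nat \<Rightarrow> real) measure set" where
  "minimizing_measures \<phi> = {\<mu>\<in>invariant_measures. (\<integral>x. \<phi> x \<partial>\<mu>) = min_average \<phi>}"

definition mather_set :: "((nat \<Rightarrow> real) \<Rightarrow> real) \<Rightarrow> (nat \<Rightarrow> real) set" where
  "mather_set \<phi> = (\<Union>\<mu>\<in>minimizing_measures \<phi>. measure_support \<mu>)"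

definition birkhoff_sum :: "((nat \<Rightarrow> real) \<Rightarrow> real) \<Rightarrow> nat \<Rightarrow> (nat \<Rightarrow> real) \<Rightarrow> real" where
  "birkhoff_sum \<psi> n x = (\<Sum>i<n. \<psi> ((left_shift ^^ i) x))"

definition mane_ball :: "(nat \<Rightarrow> real) \<Rightarrow> (nat \<Rightarrow> real) \<Rightarrow> nat \<Rightarrow> real \<Rightarrow> (nat \<Rightarrow> real) set" where
  "mane_ball x y n \<epsilon> = {z\<in>xy_space. xy_dist x z < \<epsilon> \<and> xy_dist ((left_shift ^^ n) z) y < \<epsilon>}"

text \<open>
  Extended real values, since for a merely continuous potential the infima may be unbounded below.
\<close>

definition mane_potential :: "((nat \<Rightarrow> real) \<Rightarrow> real) \<Rightarrow> (nat \<Rightarrow> real) \<Rightarrow> (nat \<Rightarrow> real) \<Rightarrow> ereal" where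
  "mane_potential \<phi> x y =
     Lim (at_right 0) (\<lambda>\<epsilon>. Inf {ereal (birkhoff_sum (\<lambda>w. \<phi> w - min_average \<phi>) n z) | n z.
                                  n \<ge> 1 \<and> z \<in> mane_ball x y n \<epsilon>})"

definition aubry_set :: "((nat \<Rightarrow> real) \<Rightarrow> real) \<Rightarrow> (nat \<Rightarrow> real) set" where
  "aubry_set \<phi> = {x\<in>xy_space. mane_potential \<phi> x x = 0}"


section \<open>Functions of class \<open>C\<^sup>r\<close> on the unit interval and the unit square\<close>

text \<open>
  Derivatives are taken relative to \<open>[0,1]\<close>, hence are one-sided at boundary points.
  Functions on \<open>[0,1]\<close> and \<open>[0,1]\<^sup>2\<close> are represented by functions which are
  extensional there, so that equality of functions is equality on the domain.
\<close>

abbreviation unit_square :: "(real \<times> real) set" where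
  "unit_square \<equiv> {0..1} \<times> {0..1}"

definition D1 :: "(real \<times> real \<Rightarrow> real) \<Rightarrow> real \<times> real \<Rightarrow> real" where
  "D1 h = (\<lambda>(x, y). vector_derivative (\<lambda>t. h (t, y)) (at x within {0..1}))"

definition D2 :: "(real \<times> real \<Rightarrow> real) \<Rightarrow> real \<times> real \<Rightarrow> real" where
  "D2 h = (\<lambda>(x, y). vector_derivative (\<lambda>t. h (x, t)) (at y within {0..1}))"

definition deriv_I :: "(real \<Rightarrow> real) \<Rightarrow> real \<Rightarrow> real" where
  "deriv_I V = (\<lambda>x. vector_derivative V (at x within {0..1}))"

primrec Cr_differentiable_sq :: "nat \<Rightarrow> (real \<times> real \<Rightarrow> real) \<Rightarrow> bool" where
  "Cr_differentiable_sq 0 h \<longleftrightarrow> continuous_on unit_square h"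
| "Cr_differentiable_sq (Suc r) h \<longleftrightarrow> continuous_on unit_square h \<and>
     (\<forall>x\<in>{0..1}. \<forall>y\<in>{0..1}. (\<lambda>t. h (t, y)) differentiable (at x within {0..1}) \<and>
                                (\<lambda>t. h (x, t)) differentiable (at y within {0..1})) \<and>
     Cr_differentiable_sq r (D1 h) \<and> Cr_differentiable_sq r (D2 h)"

primrec Cr_differentiable_I :: "nat \<Rightarrow> (real \<Rightarrow> real) \<Rightarrow> bool" where
  "Cr_differentiable_I 0 V \<longleftrightarrow> continuous_on {0..1} V"
| "Cr_differentiable_I (Suc r) V \<longleftrightarrow> continuous_on {0..1} V \<and>
     (\<forall>x\<in>{0..1}. V differentiable (at x within {0..1})) \<and> Cr_differentiable_I r (deriv_I V)"

definition Cr_sq :: "nat \<Rightarrow> (real \<times> real \<Rightarrow> real) set" where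
  "Cr_sq r = {h \<in> extensional unit_square. Cr_differentiable_sq r h}"

definition Cr_I :: "nat \<Rightarrow> (real \<Rightarrow> real) set" where
  "Cr_I r = {V \<in> extensional {0..1}. Cr_differentiable_I r V}"

text \<open>
  The order of differentiation below is immaterial, mixed partial derivatives up to order \<open>r\<close>
  of a \<open>C\<^sup>r\<close> function being symmetric.
\<close>

definition Cr_norm_sq :: "nat \<Rightarrow> (real \<times> real \<Rightarrow> real) \<Rightarrow> real" where
  "Cr_norm_sq r h =
     (\<Sum>(i, j)\<in>{(i, j). i + j \<le> r}. SUP p\<in>unit_square. \<bar>(D2 ^^ j) ((D1 ^^ i) h) p\<bar>)"

definition Cr_norm_I :: "nat \<Rightarrow> (real \<Rightarrow> real) \<Rightarrow> real" where
  "Cr_norm_I r V = (\<Sum>i\<le>r. SUP x\<in>{0..1}. \<bar>(deriv_I ^^ i) V x\<bar>)"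

definition norm_topology :: "('a \<Rightarrow> real) set \<Rightarrow> (('a \<Rightarrow> real) \<Rightarrow> real) \<Rightarrow> ('a \<Rightarrow> real) topology" where
  "norm_topology F N = topology (\<lambda>U. U \<subseteq> F \<and>
     (\<forall>f\<in>U. \<exists>\<epsilon>>0. \<forall>g\<in>F. N (\<lambda>p. g p - f p) < \<epsilon> \<longrightarrow> g \<in> U))"

lemma openin_norm_topology:
  "openin (norm_topology F N) U \<longleftrightarrow>
     U \<subseteq> F \<and> (\<forall>f\<in>U. \<exists>\<epsilon>>0. \<forall>g\<in>F. N (\<lambda>p. g p - f p) < \<epsilon> \<longrightarrow> g \<in> U)"
proof -
  let ?P = "\<lambda>U. U \<subseteq> F \<and> (\<forall>f\<in>U. \<exists>\<epsilon>>0. \<forall>g\<in>F. N (\<lambda>p. g p - f p) < \<epsilon> \<longrightarrow> g \<in> U)"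
  have "istopology ?P"
    unfolding istopology_def
  proof (intro conjI allI impI)
    fix S T assume S: "?P S" and T: "?P T"
    show "S \<inter> T \<subseteq> F" using S by blast
    show "\<forall>f\<in>S \<inter> T. \<exists>\<epsilon>>0. \<forall>g\<in>F. N (\<lambda>p. g p - f p) < \<epsilon> \<longrightarrow> g \<in> S \<inter> T"
    proof
      fix f assume f: "f \<in> S \<inter> T"
      obtain a where a: "a > 0" "\<forall>g\<in>F. N (\<lambda>p. g p - f p) < a \<longrightarrow> g \<in> S" using S f by blast
      obtain b where b: "b > 0" "\<forall>g\<in>F. N (\<lambda>p. g p - f p) < b \<longrightarrow> g \<in> T" using T f by blast
      show "\<exists>\<epsilon>>0. \<forall>g\<in>F. N (\<lambda>p. g p - f p) < \<epsilon> \<longrightarrow> g \<in> S \<inter> T"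
        using a b by (intro exI[of _ "min a b"]) auto
    qed
  next
    fix K assume K: "\<forall>S\<in>K. ?P S"
    show "\<Union>K \<subseteq> F" using K by blast
    show "\<forall>f\<in>\<Union>K. \<exists>\<epsilon>>0. \<forall>g\<in>F. N (\<lambda>p. g p - f p) < \<epsilon> \<longrightarrow> g \<in> \<Union>K"
      using K by (meson UnionE UnionI)
  qed
  then show ?thesis
    by (simp add: norm_topology_def topology_inverse')
qed

lemma topspace_norm_topology [simp]: "topspace (norm_topology F N) = F"
proof
  show "topspace (norm_topology F N) \<subseteq> F"
    by (metis openin_norm_topology openin_topspace)
  have "openin (norm_topology F N) F"
    unfolding openin_norm_topology by (auto intro: exI[of _ 1])
  then show "F \<subseteq> topspace (norm_topology F N)"
    by (rule openin_subset)
qed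

definition open_dense_in :: "'a topology \<Rightarrow> 'a set \<Rightarrow> bool" where
  "open_dense_in T U \<longleftrightarrow> openin T U \<and> T closure_of U = topspace T"

definition Cr_topology_sq :: "nat \<Rightarrow> (real \<times> real \<Rightarrow> real) topology" where
  "Cr_topology_sq r = norm_topology (Cr_sq r) (Cr_norm_sq r)"

definition Cr_topology_I :: "nat \<Rightarrow> (real \<Rightarrow> real) topology" where
  "Cr_topology_I r = norm_topology (Cr_I r) (Cr_norm_I r)"

definition twist_class :: "nat \<Rightarrow> (real \<times> real \<Rightarrow> real) set" where
  "twist_class r = {h \<in> Cr_sq r. \<forall>p\<in>unit_square. D2 (D1 h) p < 0}"

end

theory Submission
  imports Defs "HOL-Computational_Algebra.Polynomial"
begin

text \<open>
  Write \<open>f x = h (x, x) + V x\<close>, with \<open>V = 0\<close> in the first part. The twist condition \<open>D2 (D1 h) < 0\<close>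
  makes constant configurations cheapest: with a primitive \<open>u\<close> of \<open>y \<mapsto> D2 h (y, y)\<close>, the function
  \<open>y \<mapsto> h (x, y) - u y\<close> has derivative \<open>D2 h (x, y) - D2 h (y, y)\<close>, which changes sign from minus
  to plus at \<open>y = x\<close>, so that
    \<open>h (x, y) + V x \<ge> f x + u y - u x\<close>    (\<open>twist_subaction\<close>).
  Under an invariant measure the terms in \<open>u\<close> cancel, and the average of the potential is at least
  that of \<open>f (x 0)\<close>. If \<open>f\<close> attains its minimum at a single point \<open>a\<close>, the only minimizing measure
  is therefore the point mass at the constant sequence \<open>a\<close>. Along a pseudo-orbit from a
  configuration \<open>x\<close> back to itself the terms in \<open>u\<close> telescope to something arbitrarily small, while
  every visit away from \<open>a\<close> costs a definite amount; so only the constant sequence \<open>a\<close> is in the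
  Aubry set (locale \<open>diagonal_minimum\<close>).
  
  It remains to see that \<open>f\<close> has a unique minimum point for generic data. Mere uniqueness is not an
  open condition, so it is strengthened to \<open>nondegenerate_min\<close>: near the minimum point, \<open>f\<close> either
  has difference quotients bounded away from zero, or has second differences bounded below by a
  positive multiple of \<open>t\<^sup>2\<close>. This is stable under \<open>C\<^sup>2\<close>-small perturbations
  (\<open>nondegenerate_min_stable\<close>), and adding a small multiple of \<open>(x - a)\<^sup>2\<close> at an interior minimum
  point \<open>a\<close>, or of \<open>(x - a)\<^sup>2 + \<bar>x - a\<bar>\<close> at an end point, produces it
  (\<open>nondegenerate_min_perturbation\<close>).
  
  Both properties are phrased with differences instead of derivatives of \<open>f\<close>. The second difference
  of \<open>x \<mapsto> h (x, x)\<close> is a sum of two mixed differences and of pure second differences in each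
  variable, each of which is a single second derivative of \<open>h\<close> at a nearby point times \<open>t\<^sup>2\<close>
  (\<open>diagonal_second_difference_mean\<close>). Thus only \<open>D1 D1\<close>, \<open>D2 D1\<close> and \<open>D2 D2\<close> enter, which are the
  second derivatives that the norm controls directly.
\<close>

section \<open>Functions of class \<open>C\<^sup>r\<close>\<close>

lemma D1_derivative:
  assumes "Cr_differentiable_sq (Suc r) h" "x \<in> {0..1}" "y \<in> {0..1}"
  shows "((\<lambda>t. h (t, y)) has_real_derivative D1 h (x, y)) (at x within {0..1})"
  using assms by (simp add: D1_def has_real_derivative_iff_has_vector_derivative
      vector_derivative_works[symmetric])

lemma D2_derivative:
  assumes "Cr_differentiable_sq (Suc r) h" "x \<in> {0..1}" "y \<in> {0..1}"
  shows "((\<lambda>t. h (x, t)) has_real_derivative D2 h (x, y)) (at y within {0..1})"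
  using assms by (simp add: D2_def has_real_derivative_iff_has_vector_derivative
      vector_derivative_works[symmetric])

lemma deriv_I_derivative:
  assumes "Cr_differentiable_I (Suc r) V" "x \<in> {0..1}"
  shows "(V has_real_derivative deriv_I V x) (at x within {0..1})"
  using assms by (simp add: deriv_I_def has_real_derivative_iff_has_vector_derivative
      vector_derivative_works[symmetric])

lemma vector_derivative_unit_interval:
  assumes "(f has_real_derivative f') (at x within {0..1})" "x \<in> {0..1::real}"
  shows "vector_derivative f (at x within {0..1}) = f'"
  using assms vector_derivative_within_cbox[of 0 1 x f f']
  by (simp add: has_real_derivative_iff_has_vector_derivative cbox_interval)

lemma D1_eqI:
  assumes "((\<lambda>t. h (t, y)) has_real_derivative d) (at x within {0..1})" "x \<in> {0..1}"
  shows "D1 h (x, y) = d"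
  using vector_derivative_unit_interval[OF assms] by (simp add: D1_def)

lemma D2_eqI:
  assumes "((\<lambda>t. h (x, t)) has_real_derivative d) (at y within {0..1})" "y \<in> {0..1}"
  shows "D2 h (x, y) = d"
  using vector_derivative_unit_interval[OF assms] by (simp add: D2_def)

lemma deriv_I_eqI:
  assumes "(V has_real_derivative d) (at x within {0..1})" "x \<in> {0..1}"
  shows "deriv_I V x = d"
  using vector_derivative_unit_interval[OF assms] by (simp add: deriv_I_def)

lemma Cr_differentiable_sq_SucI:
  assumes "\<And>x y. x \<in> {0..1} \<Longrightarrow> y \<in> {0..1} \<Longrightarrow>
             ((\<lambda>t. h (t, y)) has_real_derivative D1 h (x, y)) (at x within {0..1})"
    and "\<And>x y. x \<in> {0..1} \<Longrightarrow> y \<in> {0..1} \<Longrightarrow>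
             ((\<lambda>t. h (x, t)) has_real_derivative D2 h (x, y)) (at y within {0..1})"
    and "continuous_on unit_square h"
    and "Cr_differentiable_sq r (D1 h)" "Cr_differentiable_sq r (D2 h)"
  shows "Cr_differentiable_sq (Suc r) h"
proof -
  have "(\<lambda>t. h (t, y)) differentiable (at x within {0..1})"
    "(\<lambda>t. h (x, t)) differentiable (at y within {0..1})" if "x \<in> {0..1}" "y \<in> {0..1}" for x y
    using assms(1,2)[OF that] real_differentiable_def by blast+
  then show ?thesis using assms(3-5) by simp
qed

lemma Cr_differentiable_I_SucI:
  assumes "\<And>x. x \<in> {0..1} \<Longrightarrow> (V has_real_derivative deriv_I V x) (at x within {0..1})"
    and "continuous_on {0..1} V" and "Cr_differentiable_I r (deriv_I V)"
  shows "Cr_differentiable_I (Suc r) V"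
proof -
  have "V differentiable (at x within {0..1})" if "x \<in> {0..1}" for x
    using assms(1)[OF that] real_differentiable_def by blast
  then show ?thesis using assms(2,3) by simp
qed

lemma D1_cong:
  assumes "\<And>p. p \<in> unit_square \<Longrightarrow> f p = g p" "p \<in> unit_square"
  shows "D1 f p = D1 g p"
proof -
  obtain x y where p: "p = (x, y)" "x \<in> {0..1}" "y \<in> {0..1}" using assms(2) by auto
  have "((\<lambda>t. f (t, y)) has_vector_derivative d) (at x within {0..1}) \<longleftrightarrow>
        ((\<lambda>t. g (t, y)) has_vector_derivative d) (at x within {0..1})" for d
    by (rule has_vector_derivative_cong_ev)
       (use assms p in \<open>auto intro!: always_eventually\<close>)
  then show ?thesis by (simp add: D1_def p vector_derivative_def)
qed

lemma D2_cong:
  assumes "\<And>p. p \<in> unit_square \<Longrightarrow> f p = g p" "p \<in> unit_square"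
  shows "D2 f p = D2 g p"
proof -
  obtain x y where p: "p = (x, y)" "x \<in> {0..1}" "y \<in> {0..1}" using assms(2) by auto
  have "((\<lambda>t. f (x, t)) has_vector_derivative d) (at y within {0..1}) \<longleftrightarrow>
        ((\<lambda>t. g (x, t)) has_vector_derivative d) (at y within {0..1})" for d
    by (rule has_vector_derivative_cong_ev)
       (use assms p in \<open>auto intro!: always_eventually\<close>)
  then show ?thesis by (simp add: D2_def p vector_derivative_def)
qed

lemma deriv_I_cong:
  assumes "\<And>x. x \<in> {0..1} \<Longrightarrow> f x = g x" "x \<in> {0..1}"
  shows "deriv_I f x = deriv_I g x"
proof -
  have "(f has_vector_derivative d) (at x within {0..1}) \<longleftrightarrow>
        (g has_vector_derivative d) (at x within {0..1})" for d
    by (rule has_vector_derivative_cong_ev)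
       (use assms in \<open>auto intro!: always_eventually\<close>)
  then show ?thesis by (simp add: deriv_I_def vector_derivative_def)
qed

lemma Cr_differentiable_sq_cong:
  assumes "Cr_differentiable_sq r f" "\<And>p. p \<in> unit_square \<Longrightarrow> f p = g p"
  shows "Cr_differentiable_sq r g"
  using assms
proof (induction r arbitrary: f g)
  case 0
  then show ?case using continuous_on_cong[of unit_square unit_square f g] by auto
next
  case (Suc r)
  have eq: "f p = g p" if "p \<in> unit_square" for p using Suc.prems(2) that by blast
  show ?case
  proof (rule Cr_differentiable_sq_SucI)
    fix x y :: real assume xy: "x \<in> {0..1}" "y \<in> {0..1}"
    have D: "D1 g (x, y) = D1 f (x, y)" "D2 g (x, y) = D2 f (x, y)"
      using D1_cong[where f = f and g = g and p = "(x, y)"]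
        D2_cong[where f = f and g = g and p = "(x, y)"] xy eq by auto
    show "((\<lambda>t. g (t, y)) has_real_derivative D1 g (x, y)) (at x within {0..1})"
      unfolding D by (rule has_field_derivative_transform_within[OF D1_derivative[OF Suc.prems(1) xy] zero_less_one])
        (use xy eq in auto)
    show "((\<lambda>t. g (x, t)) has_real_derivative D2 g (x, y)) (at y within {0..1})"
      unfolding D by (rule has_field_derivative_transform_within[OF D2_derivative[OF Suc.prems(1) xy] zero_less_one])
        (use xy eq in auto)
  next
    show "continuous_on unit_square g"
      using Suc.prems continuous_on_cong[of unit_square unit_square f g] by auto
    show "Cr_differentiable_sq r (D1 g)"
      by (rule Suc.IH[of "D1 f"]) (use Suc.prems(1) eq in \<open>auto intro: D1_cong\<close>)
    show "Cr_differentiable_sq r (D2 g)"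
      by (rule Suc.IH[of "D2 f"]) (use Suc.prems(1) eq in \<open>auto intro: D2_cong\<close>)
  qed
qed

lemma Cr_differentiable_I_cong:
  assumes "Cr_differentiable_I r f" "\<And>x. x \<in> {0..1} \<Longrightarrow> f x = g x"
  shows "Cr_differentiable_I r g"
  using assms
proof (induction r arbitrary: f g)
  case 0
  then show ?case using continuous_on_cong[of "{0..1}" "{0..1}" f g] by auto
next
  case (Suc r)
  have eq: "f p = g p" if "p \<in> {0..1}" for p using Suc.prems(2) that by blast
  show ?case
  proof (rule Cr_differentiable_I_SucI)
    fix x :: real assume x: "x \<in> {0..1}"
    have D: "deriv_I g x = deriv_I f x"
      using deriv_I_cong[where f = f and g = g and x = x] x eq by auto
    show "(g has_real_derivative deriv_I g x) (at x within {0..1})"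
      unfolding D by (rule has_field_derivative_transform_within[OF deriv_I_derivative[OF Suc.prems(1) x] zero_less_one])
        (use x eq in auto)
  next
    show "continuous_on {0..1} g"
      using Suc.prems continuous_on_cong[of "{0..1}" "{0..1}" f g] by auto
    show "Cr_differentiable_I r (deriv_I g)"
      by (rule Suc.IH[of "deriv_I f"]) (use Suc.prems(1) eq in \<open>auto intro: deriv_I_cong\<close>)
  qed
qed

lemma D1_linear:
  assumes "Cr_differentiable_sq (Suc r) f" "Cr_differentiable_sq (Suc r) g" "p \<in> unit_square"
  shows "D1 (\<lambda>p. f p + c * g p) p = D1 f p + c * D1 g p"
  using assms(3) by (auto intro!: D1_eqI derivative_eq_intros
      D1_derivative[OF assms(1)] D1_derivative[OF assms(2)])

lemma D2_linear:
  assumes "Cr_differentiable_sq (Suc r) f" "Cr_differentiable_sq (Suc r) g" "p \<in> unit_square"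
  shows "D2 (\<lambda>p. f p + c * g p) p = D2 f p + c * D2 g p"
  using assms(3) by (auto intro!: D2_eqI derivative_eq_intros
      D2_derivative[OF assms(1)] D2_derivative[OF assms(2)])

lemma deriv_I_linear:
  assumes "Cr_differentiable_I (Suc r) f" "Cr_differentiable_I (Suc r) g" "x \<in> {0..1}"
  shows "deriv_I (\<lambda>x. f x + c * g x) x = deriv_I f x + c * deriv_I g x"
  using assms(3) by (auto intro!: deriv_I_eqI derivative_eq_intros
      deriv_I_derivative[OF assms(1)] deriv_I_derivative[OF assms(2)])

lemma Cr_differentiable_sq_linear:
  assumes "Cr_differentiable_sq r f" "Cr_differentiable_sq r g"
  shows "Cr_differentiable_sq r (\<lambda>p. f p + c * g p)"
  using assms
proof (induction r arbitrary: f g)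
  case 0
  then show ?case by (auto intro!: continuous_intros)
next
  case (Suc r)
  show ?case
  proof (rule Cr_differentiable_sq_SucI)
    fix x y :: real assume xy: "x \<in> {0..1}" "y \<in> {0..1}"
    then have p: "(x, y) \<in> unit_square" by simp
    show "((\<lambda>t. f (t, y) + c * g (t, y)) has_real_derivative D1 (\<lambda>p. f p + c * g p) (x, y))
            (at x within {0..1})"
      unfolding D1_linear[OF Suc.prems p] using D1_derivative[OF Suc.prems(1) xy]
        D1_derivative[OF Suc.prems(2) xy] by (auto intro!: derivative_eq_intros)
    show "((\<lambda>t. f (x, t) + c * g (x, t)) has_real_derivative D2 (\<lambda>p. f p + c * g p) (x, y))
            (at y within {0..1})"
      unfolding D2_linear[OF Suc.prems p] using D2_derivative[OF Suc.prems(1) xy]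
        D2_derivative[OF Suc.prems(2) xy] by (auto intro!: derivative_eq_intros)
  next
    show "continuous_on unit_square (\<lambda>p. f p + c * g p)"
      using Suc.prems by (auto intro!: continuous_intros)
    show "Cr_differentiable_sq r (D1 (\<lambda>p. f p + c * g p))"
      by (rule Cr_differentiable_sq_cong[OF Suc.IH[of "D1 f" "D1 g"]])
        (use Suc.prems D1_linear[OF Suc.prems] in auto)
    show "Cr_differentiable_sq r (D2 (\<lambda>p. f p + c * g p))"
      by (rule Cr_differentiable_sq_cong[OF Suc.IH[of "D2 f" "D2 g"]])
        (use Suc.prems D2_linear[OF Suc.prems] in auto)
  qed
qed

lemma Cr_differentiable_I_linear:
  assumes "Cr_differentiable_I r f" "Cr_differentiable_I r g"
  shows "Cr_differentiable_I r (\<lambda>x. f x + c * g x)"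
  using assms
proof (induction r arbitrary: f g)
  case 0
  then show ?case by (auto intro!: continuous_intros)
next
  case (Suc r)
  show ?case
  proof (rule Cr_differentiable_I_SucI)
    fix x :: real assume x: "x \<in> {0..1}"
    show "((\<lambda>x. f x + c * g x) has_real_derivative deriv_I (\<lambda>x. f x + c * g x) x)
            (at x within {0..1})"
      unfolding deriv_I_linear[OF Suc.prems x] using deriv_I_derivative[OF Suc.prems(1) x]
        deriv_I_derivative[OF Suc.prems(2) x] by (auto intro!: derivative_eq_intros)
  next
    show "continuous_on {0..1} (\<lambda>x. f x + c * g x)"
      using Suc.prems by (auto intro!: continuous_intros)
    show "Cr_differentiable_I r (deriv_I (\<lambda>x. f x + c * g x))"
      by (rule Cr_differentiable_I_cong[OF Suc.IH[of "deriv_I f" "deriv_I g"]])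
        (use Suc.prems deriv_I_linear[OF Suc.prems] in auto)
  qed
qed

lemma Cr_differentiable_sq_antimono:
  assumes "Cr_differentiable_sq r f" "s \<le> r"
  shows "Cr_differentiable_sq s f"
  using assms
proof (induction s arbitrary: r f)
  case 0
  then show ?case by (cases r) auto
next
  case (Suc s)
  then obtain q where "r = Suc q" "s \<le> q" by (metis Suc_le_D Suc_le_mono)
  with Suc.prems(1) Suc.IH[of q "D1 f"] Suc.IH[of q "D2 f"] show ?case by auto
qed

lemma Cr_differentiable_I_antimono:
  assumes "Cr_differentiable_I r f" "s \<le> r"
  shows "Cr_differentiable_I s f"
  using assms
proof (induction s arbitrary: r f)
  case 0
  then show ?case by (cases r) auto
next
  case (Suc s)
  then obtain q where "r = Suc q" "s \<le> q" by (metis Suc_le_D Suc_le_mono)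
  with Suc.prems(1) Suc.IH[of q "deriv_I f"] show ?case by auto
qed

lemma Cr_differentiable_sq_funpow:
  assumes "Cr_differentiable_sq r f" "i + j \<le> r"
  shows "Cr_differentiable_sq (r - (i + j)) ((D2 ^^ j) ((D1 ^^ i) f))"
proof -
  have D1: "i \<le> r \<Longrightarrow> Cr_differentiable_sq (r - i) ((D1 ^^ i) f)"
  proof (induction i)
    case (Suc i)
    then have "r - i = Suc (r - Suc i)" by simp
    with Suc show ?case by simp
  qed (use assms in simp)
  show ?thesis using assms(2)
  proof (induction j)
    case 0
    then show ?case using D1 by simp
  next
    case (Suc j)
    then have "r - (i + j) = Suc (r - (i + Suc j))" by simp
    with Suc show ?case by simp
  qed
qed

lemma Cr_differentiable_I_funpow:
  assumes "Cr_differentiable_I r f" "i \<le> r"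
  shows "Cr_differentiable_I (r - i) ((deriv_I ^^ i) f)"
  using assms(2)
proof (induction i)
  case (Suc i)
  then have "r - i = Suc (r - Suc i)" by simp
  with Suc show ?case by simp
qed (use assms in simp)

text \<open>
  The suprema in the norm are those of bounded functions, derivatives up to order \<open>r\<close> being
  continuous on the compact square; this makes them honest upper bounds.
\<close>

lemma Cr_norm_sq_upper:
  assumes "Cr_differentiable_sq r f" "i + j \<le> r" "p \<in> unit_square"
  shows "\<bar>(D2 ^^ j) ((D1 ^^ i) f) p\<bar> \<le> Cr_norm_sq r f"
proof -
  let ?S = "\<lambda>(i, j). SUP p\<in>unit_square. \<bar>(D2 ^^ j) ((D1 ^^ i) f) p\<bar>"
  have upper: "\<bar>(D2 ^^ j) ((D1 ^^ i) f) p\<bar> \<le> ?S (i, j)"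
    if "i + j \<le> r" "p \<in> unit_square" for i j p
  proof -
    have "continuous_on unit_square ((D2 ^^ j) ((D1 ^^ i) f))"
      using Cr_differentiable_sq_antimono[OF Cr_differentiable_sq_funpow[OF assms(1) that(1)], of 0]
      by simp
    then have "compact ((\<lambda>p. \<bar>(D2 ^^ j) ((D1 ^^ i) f) p\<bar>) ` unit_square)"
      by (intro compact_continuous_image continuous_on_rabs) (auto intro: compact_Times)
    then show ?thesis
      using that(2) by (auto intro!: cSUP_upper dest: compact_imp_bounded bounded_imp_bdd_above)
  qed
  have "finite {(i, j). i + j \<le> r}"
    by (rule finite_subset[of _ "{..r} \<times> {..r}"]) auto
  moreover have "0 \<le> ?S q" if "q \<in> {(i, j). i + j \<le> r}" for q
    using that upper[of "fst q" "snd q" "(0, 0)"] by (auto split: prod.splits intro: order_trans[OF abs_ge_zero])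
  ultimately have "?S (i, j) \<le> Cr_norm_sq r f"
    unfolding Cr_norm_sq_def using assms(2) by (intro member_le_sum) auto
  with upper[OF assms(2,3)] show ?thesis by linarith
qed

lemma Cr_norm_I_upper:
  assumes "Cr_differentiable_I r f" "i \<le> r" "x \<in> {0..1}"
  shows "\<bar>(deriv_I ^^ i) f x\<bar> \<le> Cr_norm_I r f"
proof -
  let ?S = "\<lambda>i. SUP x\<in>{0..1}. \<bar>(deriv_I ^^ i) f x\<bar>"
  have upper: "\<bar>(deriv_I ^^ i) f x\<bar> \<le> ?S i" if "i \<le> r" "x \<in> {0..1}" for i x
  proof -
    have "continuous_on {0..1} ((deriv_I ^^ i) f)"
      using Cr_differentiable_I_antimono[OF Cr_differentiable_I_funpow[OF assms(1) that(1)], of 0]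
      by simp
    then have "compact ((\<lambda>x. \<bar>(deriv_I ^^ i) f x\<bar>) ` {0..1})"
      by (intro compact_continuous_image continuous_on_rabs) auto
    then show ?thesis
      using that(2) by (auto intro!: cSUP_upper dest: compact_imp_bounded bounded_imp_bdd_above)
  qed
  have "0 \<le> ?S q" if "q \<le> r" for q
    using upper[OF that, of 0] by (auto intro: order_trans[OF abs_ge_zero])
  then have "?S i \<le> Cr_norm_I r f"
    unfolding Cr_norm_I_def using assms(2) by (intro member_le_sum) auto
  with upper[OF assms(2,3)] show ?thesis by linarith
qed

section \<open>Mean value formulas for differences\<close>

lemma unit_interval_mvt:
  fixes k k' :: "real \<Rightarrow> real"
  assumes "\<And>t. t \<in> {0..1} \<Longrightarrow> (k has_real_derivative k' t) (at t within {0..1})"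
    and "0 \<le> x" "x < y" "y \<le> 1"
  obtains \<xi> where "x < \<xi>" "\<xi> < y" "k y - k x = k' \<xi> * (y - x)"
proof -
  have "(k has_derivative (*) (k' t)) (at t within {x..y})" if "x \<le> t" "t \<le> y" for t
    using assms(1)[of t, unfolded has_field_derivative_def] assms(2-4) that
    by (auto elim!: has_derivative_subset)
  then show ?thesis
    using mvt_simple[of x y k "\<lambda>t. (*) (k' t)"] assms(3) that by auto
qed

lemma mixed_difference_mean:
  assumes g: "Cr_differentiable_sq 2 g"
    and "0 \<le> x" "x < x'" "x' \<le> 1" "0 \<le> y" "y < y'" "y' \<le> 1"
  obtains \<xi> \<zeta> where "x < \<xi>" "\<xi> < x'" "y < \<zeta>" "\<zeta> < y'"
    "g (x', y') - g (x, y') - g (x', y) + g (x, y) = D2 (D1 g) (\<xi>, \<zeta>) * ((x' - x) * (y' - y))"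
proof -
  have g': "Cr_differentiable_sq (Suc 1) g" and Dg: "Cr_differentiable_sq (Suc 0) (D1 g)"
    using g by (simp_all add: numeral_2_eq_2)
  have "((\<lambda>t. g (t, y') - g (t, y)) has_real_derivative D1 g (t, y') - D1 g (t, y)) (at t within {0..1})"
    if "t \<in> {0..1}" for t
    using assms that by (intro DERIV_diff D1_derivative[OF g']) auto
  then obtain \<xi> where \<xi>: "x < \<xi>" "\<xi> < x'"
      "(g (x', y') - g (x', y)) - (g (x, y') - g (x, y)) = (D1 g (\<xi>, y') - D1 g (\<xi>, y)) * (x' - x)"
    by (rule unit_interval_mvt[of "\<lambda>t. g (t, y') - g (t, y)" _ x x']) (use assms in auto)
  have "((\<lambda>t. D1 g (\<xi>, t)) has_real_derivative D2 (D1 g) (\<xi>, t)) (at t within {0..1})"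
    if "t \<in> {0..1}" for t
    using assms that \<xi> by (intro D2_derivative[OF Dg]) auto
  then obtain \<zeta> where \<zeta>: "y < \<zeta>" "\<zeta> < y'"
      "D1 g (\<xi>, y') - D1 g (\<xi>, y) = D2 (D1 g) (\<xi>, \<zeta>) * (y' - y)"
    by (rule unit_interval_mvt[of "\<lambda>t. D1 g (\<xi>, t)" _ y y']) (use assms in auto)
  have "g (x', y') - g (x, y') - g (x', y) + g (x, y) = D2 (D1 g) (\<xi>, \<zeta>) * ((x' - x) * (y' - y))"
    using \<xi>(3) \<zeta>(3) by (simp add: algebra_simps)
  then show ?thesis using that \<xi> \<zeta> by blast
qed

text \<open>
  The mean value theorem, applied to \<open>s \<mapsto> k (s + t) - k s\<close> and then to \<open>k'\<close>.
\<close>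

lemma second_difference_mean:
  fixes k k' k'' :: "real \<Rightarrow> real"
  assumes k: "\<And>t. t \<in> {0..1} \<Longrightarrow> (k has_real_derivative k' t) (at t within {0..1})"
    and k': "\<And>t. t \<in> {0..1} \<Longrightarrow> (k' has_real_derivative k'' t) (at t within {0..1})"
    and t: "0 < t" "0 \<le> x - t" "x + t \<le> 1"
  obtains z where "x - t < z" "z < x + t" "k (x + t) + k (x - t) - 2 * k x = k'' z * t\<^sup>2"
proof -
  let ?q = "\<lambda>s. k (s + t) - k s"
  have kd: "(k has_real_derivative k' s) (at s)" if "0 < s" "s < 1" for s
  proof -
    have "at s within {0..1} = at s" using that by (rule at_within_Icc_at)
    then show ?thesis using k[of s] that by simp
  qed
  have kc: "continuous_on {0..1} k"
    using k by (rule DERIV_continuous_on)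
  have "continuous_on {x - t..x} ?q"
    by (intro continuous_intros continuous_on_compose2[OF kc]) (use t in auto)
  moreover have "(?q has_derivative (*) (k' (s + t) - k' s)) (at s)" if "x - t < s" "s < x" for s
  proof -
    have "((\<lambda>s. k (s + t)) has_real_derivative k' (s + t)) (at s)"
      using kd[of "s + t"] t that by (intro DERIV_shift[THEN iffD1]) auto
    moreover have "(k has_real_derivative k' s) (at s)"
      using kd[of s] t that by simp
    ultimately show ?thesis
      unfolding has_field_derivative_def[symmetric] by (rule DERIV_diff)
  qed
  ultimately obtain s where s: "x - t < s" "s < x" "?q x - ?q (x - t) = (k' (s + t) - k' s) * t"
    using mvt[of "x - t" x ?q "\<lambda>s. (*) (k' (s + t) - k' s)"] t(1) by auto
  obtain z where "s < z" "z < s + t" "k' (s + t) - k' s = k'' z * (s + t - s)"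
    by (rule unit_interval_mvt[of k' k'' s "s + t"]) (use k' s t in auto)
  then show ?thesis
    using s that[of z] by (simp add: power2_eq_square algebra_simps)
qed

lemma diagonal_difference_mean:
  assumes g: "Cr_differentiable_sq 2 g" and "0 \<le> x" "x < y" "y \<le> 1"
  obtains \<xi> \<zeta> where "x < \<xi>" "\<xi> < y" "x < \<zeta>" "\<zeta> < y"
    "g (y, y) - g (x, x) = (D1 g (\<xi>, y) + D2 g (x, \<zeta>)) * (y - x)"
proof -
  have g': "Cr_differentiable_sq (Suc 1) g"
    using g by (simp add: numeral_2_eq_2)
  obtain \<xi> where \<xi>: "x < \<xi>" "\<xi> < y" "g (y, y) - g (x, y) = D1 g (\<xi>, y) * (y - x)"
    by (rule unit_interval_mvt[of "\<lambda>t. g (t, y)" "\<lambda>t. D1 g (t, y)" x y])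
       (use assms D1_derivative[OF g'] in auto)
  obtain \<zeta> where \<zeta>: "x < \<zeta>" "\<zeta> < y" "g (x, y) - g (x, x) = D2 g (x, \<zeta>) * (y - x)"
    by (rule unit_interval_mvt[of "\<lambda>t. g (x, t)" "\<lambda>t. D2 g (x, t)" x y])
       (use assms D2_derivative[OF g'] in auto)
  show ?thesis using that[of \<xi> \<zeta>] \<xi> \<zeta> by (simp add: algebra_simps)
qed

text \<open>
  The cross through \<open>(x, x)\<close> with arms of length \<open>t\<close> splits the second difference along the diagonal:
  the two opposite squares, \<open>[x, x + t]\<^sup>2\<close> and \<open>[x - t, x]\<^sup>2\<close>, contribute mixed differences, and what
  is left over are the second differences along the two arms.
\<close>

lemma diagonal_second_difference_mean:
  assumes g: "Cr_differentiable_sq 2 g" and t: "0 < t" "0 \<le> x - t" "x + t \<le> 1"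
  obtains p q v w where
    "p \<in> {x-t<..<x+t} \<times> {x-t<..<x+t}" "q \<in> {x-t<..<x+t} \<times> {x-t<..<x+t}"
    "v \<in> {x-t<..<x+t}" "w \<in> {x-t<..<x+t}"
    "g (x + t, x + t) + g (x - t, x - t) - 2 * g (x, x) =
       (D2 (D1 g) p + D2 (D1 g) q + D1 (D1 g) (v, x) + D2 (D2 g) (x, w)) * t\<^sup>2"
proof -
  have g': "Cr_differentiable_sq (Suc 1) g" and D1g: "Cr_differentiable_sq (Suc 0) (D1 g)"
    and D2g: "Cr_differentiable_sq (Suc 0) (D2 g)"
    using g by (simp_all add: numeral_2_eq_2)
  obtain p1 p2 where p: "x < p1" "p1 < x + t" "x < p2" "p2 < x + t"
    "g (x+t, x+t) - g (x, x+t) - g (x+t, x) + g (x, x) = D2 (D1 g) (p1, p2) * ((x+t-x) * (x+t-x))"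
    by (rule mixed_difference_mean[OF g, of x "x + t" x "x + t"]) (use t in auto)
  obtain q1 q2 where q: "x - t < q1" "q1 < x" "x - t < q2" "q2 < x"
    "g (x, x) - g (x-t, x) - g (x, x-t) + g (x-t, x-t) = D2 (D1 g) (q1, q2) * ((x-(x-t)) * (x-(x-t)))"
    by (rule mixed_difference_mean[OF g, of "x - t" x "x - t" x]) (use t in auto)
  obtain v where v: "x - t < v" "v < x + t"
    "g (x+t, x) + g (x-t, x) - 2 * g (x, x) = D1 (D1 g) (v, x) * t\<^sup>2"
    by (rule second_difference_mean[of "\<lambda>s. g (s, x)" "\<lambda>s. D1 g (s, x)" "\<lambda>s. D1 (D1 g) (s, x)" t x])
       (use t D1_derivative[OF g'] D1_derivative[OF D1g] in auto)
  obtain w where w: "x - t < w" "w < x + t"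
    "g (x, x+t) + g (x, x-t) - 2 * g (x, x) = D2 (D2 g) (x, w) * t\<^sup>2"
    by (rule second_difference_mean[of "\<lambda>s. g (x, s)" "\<lambda>s. D2 g (x, s)" "\<lambda>s. D2 (D2 g) (x, s)" t x])
       (use t D2_derivative[OF g'] D2_derivative[OF D2g] in auto)
  have "g (x + t, x + t) + g (x - t, x - t) - 2 * g (x, x) =
       (D2 (D1 g) (p1, p2) + D2 (D1 g) (q1, q2) + D1 (D1 g) (v, x) + D2 (D2 g) (x, w)) * t\<^sup>2"
    using p(5) q(5) v(3) w(3) by (simp add: algebra_simps power2_eq_square)
  then show ?thesis
    using that[of "(p1, p2)" "(q1, q2)" v w] p q v w t by auto
qed

section \<open>The sub-action of a twist function\<close>

text \<open>
  A function \<open>u\<close> with this property must have \<open>u' y = D2 h (y, y)\<close>, since equality holds at \<open>y = x\<close>.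
  Conversely, integrating the twist condition in the first variable shows that \<open>D2 h (x, y)\<close>
  decreases in \<open>x\<close>, so any primitive of \<open>D2 h (y, y)\<close> works.
\<close>

lemma twist_subaction:
  assumes h: "Cr_differentiable_sq 2 h" and twist: "\<And>p. p \<in> unit_square \<Longrightarrow> D2 (D1 h) p < 0"
  obtains u where "continuous_on {0..1} u"
    "\<And>x y. x \<in> {0..1} \<Longrightarrow> y \<in> {0..1} \<Longrightarrow> h (x, x) + u y - u x \<le> h (x, y)"
proof -
  have h': "Cr_differentiable_sq (Suc 1) h"
    using h by (simp add: numeral_2_eq_2)
  \<comment> \<open>the twist condition without derivatives\<close>
  have mixed: "h (x', y') - h (x, y') \<le> h (x', y) - h (x, y)"
    if xy: "0 \<le> x" "x \<le> x'" "x' \<le> 1" "0 \<le> y" "y \<le> y'" "y' \<le> 1" for x x' y y'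
  proof (cases "x < x' \<and> y < y'")
    case True
    then obtain \<xi> \<zeta> where "x < \<xi>" "\<xi> < x'" "y < \<zeta>" "\<zeta> < y'"
      "h (x', y') - h (x, y') - h (x', y) + h (x, y) = D2 (D1 h) (\<xi>, \<zeta>) * ((x' - x) * (y' - y))"
      using xy mixed_difference_mean[OF h, of x x' y y'] by blast
    moreover from this have "D2 (D1 h) (\<xi>, \<zeta>) * ((x' - x) * (y' - y)) \<le> 0"
      using xy twist[of "(\<xi>, \<zeta>)"] by (intro mult_nonpos_nonneg) auto
    ultimately show ?thesis by linarith
  next
    case False
    then have "x = x' \<or> y = y'" using xy by auto
    then show ?thesis by auto
  qed
  have D2_mono: "D2 h (x', y) \<le> D2 h (x, y)" if "0 \<le> x" "x \<le> x'" "x' \<le> 1" "y \<in> {0..1}" for x x' y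
  proof -
    have "((\<lambda>t. h (x, t) - h (x', t)) has_real_derivative D2 h (x, y) - D2 h (x', y)) (at y within {0..1})"
      using that by (intro DERIV_diff D2_derivative[OF h']) auto
    moreover have "mono_on {0..1} (\<lambda>t. h (x, t) - h (x', t))"
    proof (rule mono_onI)
      fix s t :: real assume "s \<in> {0..1}" "t \<in> {0..1}" "s \<le> t"
      then show "h (x, s) - h (x', s) \<le> h (x, t) - h (x', t)"
        using mixed[of x x' s t] that by auto
    qed
    then have "0 \<le> ((h (x, t) - h (x', t)) - (h (x, y) - h (x', y))) / (t - y)" if "t \<in> {0..1}" for t
      using mono_onD[of "{0..1}" "\<lambda>t. h (x, t) - h (x', t)" t y]
        mono_onD[of "{0..1}" "\<lambda>t. h (x, t) - h (x', t)" y t] \<open>y \<in> {0..1}\<close> that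
      by (cases "t \<le> y") (simp_all add: zero_le_divide_iff)
    then have "\<forall>\<^sub>F t in at y within {0..1}. 0 \<le> ((h (x, t) - h (x', t)) - (h (x, y) - h (x', y))) / (t - y)"
      by (simp add: eventually_at_filter)
    moreover have "at y within {0..1} \<noteq> bot"
      using that(4) islimpt_Icc[of 0 1 y] by (simp add: trivial_limit_within)
    ultimately have "0 \<le> D2 h (x, y) - D2 h (x', y)"
      by (intro tendsto_lowerbound) (auto simp: has_field_derivative_iff)
    then show ?thesis by simp
  qed
  have "continuous_on {0..1} (\<lambda>s. D2 h (s, s))"
    by (rule continuous_on_compose2[of unit_square "D2 h"])
       (use h' in \<open>auto intro!: continuous_intros\<close>)
  then obtain u where "\<And>s. s \<in> {0..1} \<Longrightarrow> (u has_vector_derivative D2 h (s, s)) (at s within {0..1})"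
    by (rule antiderivative_continuous) blast
  then have u: "\<And>s. s \<in> {0..1} \<Longrightarrow> (u has_real_derivative D2 h (s, s)) (at s within {0..1})"
    by (simp add: has_real_derivative_iff_has_vector_derivative)
  show ?thesis
  proof
    show "continuous_on {0..1} u"
      using u by (rule DERIV_continuous_on)
    fix x y :: real assume xy: "x \<in> {0..1}" "y \<in> {0..1}"
    have d: "((\<lambda>t. h (x, t) - u t) has_real_derivative D2 h (x, t) - D2 h (t, t)) (at t within {0..1})"
      if "t \<in> {0..1}" for t
      using xy that by (intro DERIV_diff D2_derivative[OF h'] u) auto
    consider "x = y" | "x < y" | "y < x" by linarith
    then show "h (x, x) + u y - u x \<le> h (x, y)"
    proof cases
      case 2
      then obtain s where s: "x < s" "s < y"
        "(h (x, y) - u y) - (h (x, x) - u x) = (D2 h (x, s) - D2 h (s, s)) * (y - x)"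
        using unit_interval_mvt[OF d, of x y] xy by auto
      have "0 \<le> (D2 h (x, s) - D2 h (s, s)) * (y - x)"
        using D2_mono[of x s s] s xy 2 by (intro mult_nonneg_nonneg) auto
      then show ?thesis using s by linarith
    next
      case 3
      then obtain s where s: "y < s" "s < x"
        "(h (x, x) - u x) - (h (x, y) - u y) = (D2 h (x, s) - D2 h (s, s)) * (x - y)"
        using unit_interval_mvt[OF d, of y x] xy by auto
      have "(D2 h (x, s) - D2 h (s, s)) * (x - y) \<le> 0"
        using D2_mono[of s x s] s xy 3 by (intro mult_nonpos_nonneg) auto
      then show ?thesis using s by linarith
    qed simp
  qed
qed

section \<open>Mather and Aubry sets in the presence of a sub-action\<close>

abbreviation xy_borel :: "(nat \<Rightarrow> real) measure" where
  "xy_borel \<equiv> restrict_space borel xy_space"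

lemma continuous_on_coordinate: "continuous_on A (\<lambda>x :: nat \<Rightarrow> real. x i)"
  by (rule continuous_on_subset[OF continuous_on_product_coordinates]) simp

lemma left_shift_funpow: "(left_shift ^^ n) x = (\<lambda>i. x (i + n))"
  by (induction n arbitrary: x) (auto simp: left_shift_def)

lemma left_shift_measurable: "left_shift \<in> measurable xy_borel xy_borel"
proof (rule measurable_restrict_space2)
  show "left_shift \<in> space xy_borel \<rightarrow> xy_space"
    by (auto simp: left_shift_def xy_space_def space_restrict_space)
  have "continuous_on xy_space left_shift"
    unfolding left_shift_def
    by (rule continuous_on_coordinatewise_then_product) (rule continuous_on_coordinate)
  then show "left_shift \<in> borel_measurable xy_borel"
    by (rule borel_measurable_continuous_on_restrict)
qed

text \<open>
  Only the first few coordinates ever enter; integrands depending continuously on two coordinates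
  cover the potential and all the comparison terms.
\<close>

lemma coordinates_integrable:
  fixes F :: "real \<times> real \<Rightarrow> real"
  assumes "prob_space \<mu>" "sets \<mu> = sets xy_borel" "continuous_on unit_square F"
  shows "integrable \<mu> (\<lambda>x. F (x i, x j))"
proof -
  interpret prob_space \<mu> by fact
  have sp: "space \<mu> = xy_space"
    using sets_eq_imp_space_eq[OF assms(2)] by (simp add: space_restrict_space)
  have "continuous_on xy_space (\<lambda>x. F (x i, x j))"
    by (rule continuous_on_compose2[OF assms(3)])
       (auto intro!: continuous_intros continuous_on_coordinate simp: xy_space_def)
  then have m: "(\<lambda>x. F (x i, x j)) \<in> borel_measurable \<mu>"
    using borel_measurable_continuous_on_restrict measurable_cong_sets[OF assms(2) refl] by blast
  have "compact (F ` unit_square)"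
    using assms(3) by (intro compact_continuous_image) (auto intro: compact_Times)
  then obtain B where "\<And>p. p \<in> unit_square \<Longrightarrow> norm (F p) \<le> B"
    by (meson bounded_iff compact_imp_bounded imageI)
  then have "AE x in \<mu>. norm (F (x i, x j)) \<le> B"
    by (intro AE_I2) (auto simp: sp xy_space_def)
  then show ?thesis using m by (rule integrable_const_bound[where f = "\<lambda>x. F (x i, x j)" and B = B])
qed

lemma invariant_integral_shift:
  fixes F :: "real \<times> real \<Rightarrow> real"
  assumes "\<mu> \<in> invariant_measures" "continuous_on unit_square F"
  shows "(\<integral>x. F (x (Suc i), x (Suc j)) \<partial>\<mu>) = (\<integral>x. F (x i, x j) \<partial>\<mu>)"
proof -
  have \<mu>: "prob_space \<mu>" "sets \<mu> = sets xy_borel" "distr \<mu> \<mu> left_shift = \<mu>"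
    using assms(1) by (auto simp: invariant_measures_def)
  have "(\<lambda>x. F (x i, x j)) \<in> borel_measurable \<mu>"
    by (rule borel_measurable_integrable[OF coordinates_integrable[OF \<mu>(1,2) assms(2)]])
  moreover have "left_shift \<in> measurable \<mu> \<mu>"
    using left_shift_measurable measurable_cong_sets[OF \<mu>(2) \<mu>(2)] by blast
  ultimately have "(\<integral>x. F (x i, x j) \<partial>distr \<mu> \<mu> left_shift) = (\<integral>x. F (left_shift x i, left_shift x j) \<partial>\<mu>)"
    using integral_distr[where f = "\<lambda>x. F (x i, x j)" and M = \<mu> and N = \<mu> and g = left_shift] by blast
  then show ?thesis by (simp add: \<mu>(3) left_shift_def)
qed

text \<open>
  The situation to which the twist condition reduces the theorem: a potential \<open>F (x 0, x 1)\<close> that is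
  bounded below by its diagonal values up to the coboundary of \<open>u\<close>, with a unique minimum on the
  diagonal.
\<close>

locale diagonal_minimum =
  fixes F :: "real \<times> real \<Rightarrow> real" and u :: "real \<Rightarrow> real" and a :: real
  assumes F_cont: "continuous_on unit_square F"
    and u_cont: "continuous_on {0..1} u"
    and subaction: "\<And>x y. x \<in> {0..1} \<Longrightarrow> y \<in> {0..1} \<Longrightarrow> F (x, x) + u y - u x \<le> F (x, y)"
    and a: "a \<in> {0..1}"
    and a_min: "\<And>x. x \<in> {0..1} \<Longrightarrow> x \<noteq> a \<Longrightarrow> F (a, a) < F (x, x)"
begin

abbreviation "\<phi> \<equiv> \<lambda>x :: nat \<Rightarrow> real. F (x 0, x 1)"
abbreviation "fixpt \<equiv> \<lambda>_ :: nat. a"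

lemma fixpt: "fixpt \<in> xy_space" "left_shift fixpt = fixpt"
  using a by (auto simp: xy_space_def left_shift_def)

lemma diagonal_ge: "x \<in> {0..1} \<Longrightarrow> F (a, a) \<le> F (x, x)"
  using a_min[of x] by (cases "x = a") auto

lemma diagonal_cont: "continuous_on {0..1} (\<lambda>x. F (x, x))"
  by (rule continuous_on_compose2[OF F_cont]) (auto intro!: continuous_intros)

lemma integral_ge_diagonal:
  assumes "\<mu> \<in> invariant_measures"
  shows "(\<integral>x. F (x 0, x 0) \<partial>\<mu>) \<le> (\<integral>x. \<phi> x \<partial>\<mu>)"
proof -
  have \<mu>: "prob_space \<mu>" "sets \<mu> = sets xy_borel"
    using assms by (auto simp: invariant_measures_def)
  have sp: "space \<mu> = xy_space"
    using sets_eq_imp_space_eq[OF \<mu>(2)] by (simp add: space_restrict_space)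
  have u': "continuous_on unit_square (\<lambda>(x, y). u x)"
    by (auto simp: split_beta intro!: continuous_on_compose2[OF u_cont] continuous_intros)
  note int = coordinates_integrable[OF \<mu> F_cont, of 0] coordinates_integrable[OF \<mu> u', of 0 0]
    coordinates_integrable[OF \<mu> u', of "Suc 0" "Suc 0"]
  have "(\<integral>x. F (x 0, x 0) + u (x (Suc 0)) - u (x 0) \<partial>\<mu>) \<le> (\<integral>x. \<phi> x \<partial>\<mu>)"
    by (rule integral_mono) (use int subaction in \<open>auto simp: sp xy_space_def\<close>)
  then show ?thesis
    using invariant_integral_shift[OF assms u', of 0 0] int by simp
qed

lemma integral_ge:
  assumes "\<mu> \<in> invariant_measures"
  shows "F (a, a) \<le> (\<integral>x. F (x 0, x 0) \<partial>\<mu>)"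
proof -
  have \<mu>: "prob_space \<mu>" "sets \<mu> = sets xy_borel"
    using assms by (auto simp: invariant_measures_def)
  interpret prob_space \<mu> by fact
  have sp: "space \<mu> = xy_space"
    using sets_eq_imp_space_eq[OF \<mu>(2)] by (simp add: space_restrict_space)
  show ?thesis
    by (rule integral_ge_const[OF coordinates_integrable[OF \<mu> F_cont]])
       (auto intro!: AE_I2 diagonal_ge simp: sp xy_space_def)
qed

lemma return_fixpt: "return xy_borel fixpt \<in> invariant_measures"
  unfolding invariant_measures_def
proof (intro CollectI conjI)
  have sp: "fixpt \<in> space xy_borel" using fixpt by (simp add: space_restrict_space)
  show "prob_space (return xy_borel fixpt)" using sp by (rule prob_space_return)
  show "sets (return xy_borel fixpt) = sets xy_borel" by simp
  have "distr (return xy_borel fixpt) xy_borel left_shift = return xy_borel (left_shift fixpt)"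
    by (rule distr_return[OF left_shift_measurable sp])
  then show "distr (return xy_borel fixpt) (return xy_borel fixpt) left_shift = return xy_borel fixpt"
    using fixpt by (metis distr_cong sets_return)
qed

lemma integral_return_fixpt: "(\<integral>x. \<phi> x \<partial>return xy_borel fixpt) = F (a, a)"
proof -
  have "prob_space (return xy_borel fixpt)"
    using return_fixpt by (auto simp: invariant_measures_def)
  then have "\<phi> \<in> borel_measurable (return xy_borel fixpt)"
    using coordinates_integrable[OF _ _ F_cont, of "return xy_borel fixpt" 0 1] by auto
  then show ?thesis
    using fixpt by (subst integral_return) (auto simp: space_restrict_space)
qed

lemma min_average_eq: "min_average \<phi> = F (a, a)"
  unfolding min_average_def
proof (rule cInf_eq_minimum)
  show "F (a, a) \<in> (\<lambda>\<mu>. \<integral>x. \<phi> x \<partial>\<mu>) ` invariant_measures"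
    by (rule image_eqI[where x = "return xy_borel fixpt"])
       (rule integral_return_fixpt[symmetric], rule return_fixpt)
  show "F (a, a) \<le> v" if v: "v \<in> (\<lambda>\<mu>. \<integral>x. \<phi> x \<partial>\<mu>) ` invariant_measures" for v
  proof -
    obtain \<mu> where "\<mu> \<in> invariant_measures" "v = (\<integral>x. \<phi> x \<partial>\<mu>)"
      using v by (rule imageE)
    then show ?thesis using order_trans[OF integral_ge integral_ge_diagonal] by blast
  qed
qed

text \<open>
  Minimality forces \<open>x 0 = a\<close> almost everywhere, and invariance carries this over to every coordinate.
\<close>

lemma minimizing_AE_fixpt:
  assumes "\<mu> \<in> minimizing_measures \<phi>"
  shows "AE x in \<mu>. x = fixpt"
proof -
  have inv: "\<mu> \<in> invariant_measures" and min: "(\<integral>x. \<phi> x \<partial>\<mu>) = F (a, a)"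
    using assms min_average_eq by (simp_all add: minimizing_measures_def del: One_nat_def)
  have \<mu>: "prob_space \<mu>" "sets \<mu> = sets xy_borel" "distr \<mu> \<mu> left_shift = \<mu>"
    using inv by (auto simp: invariant_measures_def)
  interpret prob_space \<mu> by fact
  have sp: "space \<mu> = xy_space"
    using sets_eq_imp_space_eq[OF \<mu>(2)] by (simp add: space_restrict_space)
  have "(\<integral>x. F (x 0, x 0) - F (a, a) \<partial>\<mu>) = 0"
    using integral_ge[OF inv] integral_ge_diagonal[OF inv] min
      coordinates_integrable[OF \<mu>(1,2) F_cont, of 0 0] prob_space by simp
  then have "AE x in \<mu>. F (x 0, x 0) - F (a, a) = 0"
    by (subst (asm) integral_nonneg_eq_0_iff_AE)
       (auto intro!: AE_I2 diagonal_ge coordinates_integrable[OF \<mu>(1,2) F_cont] simp: sp xy_space_def)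
  then have "AE x in \<mu>. x 0 = a"
    by (rule AE_mp) (use a_min in \<open>force intro!: AE_I2 simp: sp xy_space_def\<close>)
  moreover have "AE x in \<mu>. x (Suc i) = a" if "AE x in \<mu>. x i = a" for i
  proof -
    have "left_shift \<in> measurable \<mu> \<mu>"
      using left_shift_measurable measurable_cong_sets[OF \<mu>(2) \<mu>(2)] by blast
    moreover have "(\<lambda>x. x i) \<in> borel_measurable \<mu>"
      using borel_measurable_continuous_on_restrict[OF continuous_on_coordinate]
        measurable_cong_sets[OF \<mu>(2) refl] by blast
    then have "{x \<in> space \<mu>. x i = a} \<in> sets \<mu>" by measurable
    moreover have "AE x in distr \<mu> \<mu> left_shift. x i = a" by (subst \<mu>(3)) (rule that)
    ultimately show ?thesis by (simp add: AE_distr_iff left_shift_def)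
  qed
  ultimately have "AE x in \<mu>. x i = a" for i by (induction i) auto
  then have "AE x in \<mu>. \<forall>i. x i = a" by (simp add: AE_all_countable)
  then show ?thesis by (rule AE_mp) (auto intro!: AE_I2)
qed

lemma minimizing_support:
  assumes "\<mu> \<in> minimizing_measures \<phi>"
  shows "measure_support \<mu> = {fixpt}"
proof -
  have \<mu>: "prob_space \<mu>" "sets \<mu> = sets xy_borel"
    using assms by (auto simp: minimizing_measures_def invariant_measures_def)
  interpret prob_space \<mu> by fact
  have ae: "AE x in \<mu>. x = fixpt" by (rule minimizing_AE_fixpt[OF assms])
  have meas: "U \<in> sets \<mu>" if "openin (top_of_set xy_space) U" for U
    using that by (auto simp: \<mu>(2) sets_restrict_space openin_open)
  show ?thesis
  proof (intro equalityI subsetI)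
    fix x assume x: "x \<in> measure_support \<mu>"
    show "x \<in> {fixpt}"
    proof (rule ccontr)
      assume "x \<notin> {fixpt}"
      let ?U = "xy_space \<inter> - {fixpt}"
      have U: "openin (top_of_set xy_space) ?U"
        by (intro openin_open_Int) auto
      have "x \<in> ?U" using x \<open>x \<notin> {fixpt}\<close> by (auto simp: measure_support_def)
      with x U have "emeasure \<mu> ?U > 0" by (auto simp: measure_support_def)
      moreover have "AE y in \<mu>. y \<notin> ?U" using ae by (rule AE_mp) (auto intro!: AE_I2)
      then have "emeasure \<mu> ?U = 0" using AE_iff_null_sets[OF meas[OF U]] by (simp add: null_setsD1)
      ultimately show False by simp
    qed
  next
    fix x assume "x \<in> {fixpt}"
    have "emeasure \<mu> U > 0" if U: "openin (top_of_set xy_space) U" "fixpt \<in> U" for U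
    proof -
      have "AE y in \<mu>. y \<in> U" using ae by (rule AE_mp) (use U in \<open>auto intro!: AE_I2\<close>)
      then have "emeasure \<mu> U = 1" by (rule emeasure_eq_1_AE[OF meas[OF U(1)]])
      then show ?thesis by simp
    qed
    then show "x \<in> measure_support \<mu>"
      using \<open>x \<in> {fixpt}\<close> fixpt by (auto simp: measure_support_def)
  qed
qed

lemma mather_set_eq: "mather_set \<phi> = {fixpt}"
proof -
  have "return xy_borel fixpt \<in> minimizing_measures \<phi>"
    using return_fixpt integral_return_fixpt min_average_eq by (simp add: minimizing_measures_def)
  then show ?thesis
    unfolding mather_set_def using minimizing_support by auto
qed

lemma birkhoff_sum_ge:
  assumes "z \<in> xy_space"
  shows "(\<Sum>i<n. F (z i, z i) - F (a, a)) + u (z n) - u (z 0)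
         \<le> birkhoff_sum (\<lambda>w. \<phi> w - min_average \<phi>) n z"
proof (induction n)
  case (Suc n)
  have "F (z n, z n) + u (z (Suc n)) - u (z n) \<le> F (z n, z (Suc n))"
    using assms by (intro subaction) (auto simp: xy_space_def)
  with Suc show ?case
    by (simp add: birkhoff_sum_def left_shift_funpow min_average_eq[unfolded One_nat_def])
qed (simp add: birkhoff_sum_def)

lemma birkhoff_sum_ge_term:
  assumes "z \<in> xy_space" "k < n"
  shows "F (z k, z k) - F (a, a) + u (z n) - u (z 0)
         \<le> birkhoff_sum (\<lambda>w. \<phi> w - min_average \<phi>) n z"
proof -
  have "F (z k, z k) - F (a, a) \<le> (\<Sum>i<n. F (z i, z i) - F (a, a))"
    using assms diagonal_ge by (intro member_le_sum) (auto simp: xy_space_def)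
  with birkhoff_sum_ge[OF assms(1), of n] show ?thesis by linarith
qed

lemma birkhoff_sum_ge_ends:
  assumes "z \<in> xy_space"
  shows "u (z n) - u (z 0) \<le> birkhoff_sum (\<lambda>w. \<phi> w - min_average \<phi>) n z"
proof -
  have "0 \<le> (\<Sum>i<n. F (z i, z i) - F (a, a))"
    using assms diagonal_ge by (intro sum_nonneg) (auto simp: xy_space_def)
  with birkhoff_sum_ge[OF assms(1), of n] show ?thesis by linarith
qed

abbreviation "loops x \<epsilon> \<equiv>
  {ereal (birkhoff_sum (\<lambda>w. \<phi> w - min_average \<phi>) n z) | n z. n \<ge> 1 \<and> z \<in> mane_ball x x n \<epsilon>}"

lemma mane_ballD:
  assumes "x \<in> xy_space" "z \<in> mane_ball x x n \<epsilon>"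
  shows "z \<in> xy_space" "\<bar>z i - x i\<bar> < 2 ^ i * \<epsilon>" "\<bar>z (i + n) - x i\<bar> < 2 ^ i * \<epsilon>"
proof -
  show z: "z \<in> xy_space" using assms by (simp add: mane_ball_def)
  have zn: "(left_shift ^^ n) z \<in> xy_space" using z by (auto simp: left_shift_funpow xy_space_def)
  have 1: "xy_dist x z < \<epsilon>" "xy_dist ((left_shift ^^ n) z) x < \<epsilon>"
    using assms by (auto simp: mane_ball_def)
  have "\<bar>x i - z i\<bar> \<le> 2 ^ i * xy_dist x z" by (rule xy_dist_coord[OF assms(1) z])
  also have "\<dots> < 2 ^ i * \<epsilon>" using 1 by simp
  finally show "\<bar>z i - x i\<bar> < 2 ^ i * \<epsilon>" by (simp add: abs_minus_commute)
  have "\<bar>z (i + n) - x i\<bar> \<le> 2 ^ i * xy_dist ((left_shift ^^ n) z) x"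
    using xy_dist_coord[OF zn assms(1), of i] by (simp add: left_shift_funpow)
  also have "\<dots> < 2 ^ i * \<epsilon>" using 1 by simp
  finally show "\<bar>z (i + n) - x i\<bar> < 2 ^ i * \<epsilon>" .
qed

text \<open>
  Both ends of a loop at \<open>x\<close> have zeroth coordinate close to \<open>x 0\<close>, so the telescoped sum of \<open>u\<close> along
  the loop is negligible.
\<close>

lemma loop_ends:
  assumes "x \<in> xy_space" "e > 0"
  obtains d where "d > 0" "\<And>\<epsilon> n z. \<epsilon> \<le> d \<Longrightarrow> z \<in> mane_ball x x n \<epsilon> \<Longrightarrow> \<bar>u (z n) - u (z 0)\<bar> < e"
proof -
  have "x 0 \<in> {0..1}" using assms by (auto simp: xy_space_def)
  with u_cont assms(2) obtain d where d: "d > 0"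
      "\<And>y. y \<in> {0..1} \<Longrightarrow> \<bar>y - x 0\<bar> < d \<Longrightarrow> \<bar>u y - u (x 0)\<bar> < e / 2"
    unfolding continuous_on_iff dist_real_def by (metis half_gt_zero)
  show ?thesis
  proof (rule that[OF d(1)])
    fix \<epsilon> n z assume "\<epsilon> \<le> d" and z: "z \<in> mane_ball x x n \<epsilon>"
    then have "\<bar>u (z n) - u (x 0)\<bar> < e / 2" "\<bar>u (z 0) - u (x 0)\<bar> < e / 2"
      using mane_ballD(1)[OF assms(1) z] mane_ballD(2,3)[OF assms(1) z, of 0] \<open>\<epsilon> \<le> d\<close> by (intro d(2); force simp: xy_space_def)+
    then show "\<bar>u (z n) - u (z 0)\<bar> < e" by linarith
  qed
qed

text \<open>
  The constant loop has action zero, and by \<open>birkhoff_sum_ge_ends\<close> no loop with nearby ends does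
  essentially better.
\<close>

lemma mane_potential_fixpt: "mane_potential \<phi> fixpt fixpt = 0"
proof -
  have "((\<lambda>\<epsilon>. Inf (loops fixpt \<epsilon>)) \<longlongrightarrow> 0) (at_right 0)"
  proof (rule order_tendstoI)
    fix c :: ereal assume "0 < c"
    have "Inf (loops fixpt \<epsilon>) \<le> 0" if "\<epsilon> > 0" for \<epsilon>
    proof (rule Inf_lower)
      have "fixpt \<in> mane_ball fixpt fixpt 1 \<epsilon>"
        using that fixpt by (auto simp: mane_ball_def xy_dist_def)
      moreover have "birkhoff_sum (\<lambda>w. \<phi> w - min_average \<phi>) 1 fixpt = 0"
        by (simp add: birkhoff_sum_def min_average_eq[unfolded One_nat_def])
      ultimately show "0 \<in> loops fixpt \<epsilon>"
        by (intro CollectI exI[of _ 1] exI[of _ fixpt]) (auto simp: zero_ereal_def)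
    qed
    then show "\<forall>\<^sub>F \<epsilon> in at_right 0. Inf (loops fixpt \<epsilon>) < c"
      using \<open>0 < c\<close> by (intro eventually_mono[OF eventually_at_right_less]) (rule le_less_trans)
  next
    fix c :: ereal assume "c < 0"
    then obtain e :: real where e: "e < 0" "c < ereal e"
      using ereal_dense2[of c 0] by (auto simp: zero_ereal_def)
    obtain d where d: "d > 0"
      "\<And>\<epsilon> n z. \<epsilon> \<le> d \<Longrightarrow> z \<in> mane_ball fixpt fixpt n \<epsilon> \<Longrightarrow> \<bar>u (z n) - u (z 0)\<bar> < - e"
      using loop_ends[OF fixpt(1), of "- e"] e by auto
    have "ereal e \<le> Inf (loops fixpt \<epsilon>)" if "\<epsilon> < d" for \<epsilon>
    proof (rule Inf_greatest, clarify)
      fix n z assume z: "z \<in> mane_ball fixpt fixpt n \<epsilon>"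
      show "ereal e \<le> ereal (birkhoff_sum (\<lambda>w. \<phi> w - min_average \<phi>) n z)"
        using d(2)[OF _ z] that birkhoff_sum_ge_ends[OF mane_ballD(1)[OF fixpt(1) z], of n] by auto
    qed
    then show "\<forall>\<^sub>F \<epsilon> in at_right 0. c < Inf (loops fixpt \<epsilon>)"
      using e(2) d(1) unfolding eventually_at_right_field by (meson less_le_trans)
  qed
  then show ?thesis
    unfolding mane_potential_def by (intro tendsto_Lim) auto
qed

text \<open>
  Let \<open>k\<close> be the first index with \<open>x k \<noteq> a\<close>. A loop at \<open>x\<close> of length \<open>n > k\<close> passes near \<open>x k\<close> at time \<open>k\<close>
  and pays for it. A loop of length \<open>1 \<le> n \<le> k\<close> would have its \<open>k\<close>-th coordinate near both \<open>x k\<close> and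
  \<open>x (k - n) = a\<close>, which is impossible for small errors.
\<close>

lemma mane_potential_pos:
  assumes x: "x \<in> xy_space" "x \<noteq> fixpt"
  shows "mane_potential \<phi> x x > 0"
proof -
  define k where "k = (LEAST k. x k \<noteq> a)"
  have "\<exists>k. x k \<noteq> a" using x(2) by auto
  then have k: "x k \<noteq> a" and k_least: "\<And>i. i < k \<Longrightarrow> x i = a"
    unfolding k_def by (rule LeastI_ex) (use not_less_Least in blast)
  have xk: "x k \<in> {0..1}" using x by (auto simp: xy_space_def)
  define c where "c = (F (x k, x k) - F (a, a)) / 2"
  have c: "c > 0" using a_min[OF xk k] by (simp add: c_def)
  obtain d1 where d1: "d1 > 0"
    "\<And>\<epsilon> n z. \<epsilon> \<le> d1 \<Longrightarrow> z \<in> mane_ball x x n \<epsilon> \<Longrightarrow> \<bar>u (z n) - u (z 0)\<bar> < c / 2"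
    using loop_ends[OF x(1), of "c / 2"] c by auto
  obtain d2 where d2: "d2 > 0"
    "\<And>y. y \<in> {0..1} \<Longrightarrow> \<bar>y - x k\<bar> < d2 \<Longrightarrow> \<bar>F (y, y) - F (x k, x k)\<bar> < c"
    using diagonal_cont xk c unfolding continuous_on_iff dist_real_def by metis
  \<comment> \<open>distances below \<open>d\<close> control coordinate \<open>k\<close> up to a factor \<open>2 ^ k\<close>\<close>
  define d where "d = Min {d1, d2 / 2 ^ k, \<bar>x k - a\<bar> / (2 * 2 ^ k)}"
  have d: "d > 0" "d \<le> d1" "2 ^ k * d \<le> d2" "2 * 2 ^ k * d \<le> \<bar>x k - a\<bar>"
  proof -
    show "d > 0" unfolding d_def using d1 d2 k by auto
    show "d \<le> d1" unfolding d_def by (rule Min_le) auto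
    have "d \<le> d2 / 2 ^ k" unfolding d_def by (rule Min_le) auto
    then show "2 ^ k * d \<le> d2" by (simp add: field_simps)
    have "d \<le> \<bar>x k - a\<bar> / (2 * 2 ^ k)" unfolding d_def by (rule Min_le) auto
    then show "2 * 2 ^ k * d \<le> \<bar>x k - a\<bar>" by (simp add: field_simps)
  qed
  have lower: "ereal (c / 2) \<le> Inf (loops x d)"
  proof (rule Inf_greatest, clarify)
    fix n :: nat and z assume n: "1 \<le> n" and z: "z \<in> mane_ball x x n d"
    note zD = mane_ballD[OF x(1) z]
    have "k < n"
    proof (rule ccontr)
      assume "\<not> k < n"
      then have kn: "k - n + n = k" and "k - n < k" using n by auto
      then have "\<bar>z k - a\<bar> < 2 ^ (k - n) * d"
        using zD(3)[of "k - n"] k_least[of "k - n"] by simp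
      also have "\<dots> \<le> 2 ^ k * d" using d(1) by (intro mult_right_mono power_increasing) auto
      finally show False using zD(2)[of k] d(4) by linarith
    qed
    have "\<bar>z k - x k\<bar> < d2" using zD(2)[of k] d(3) by linarith
    then have "\<bar>F (z k, z k) - F (x k, x k)\<bar> < c"
      using zD(1) by (intro d2) (auto simp: xy_space_def)
    then have "F (x k, x k) - F (z k, z k) < c" by (simp only: abs_less_iff minus_diff_eq)
    moreover have "F (x k, x k) - F (a, a) = 2 * c" by (simp add: c_def)
    ultimately have "c \<le> F (z k, z k) - F (a, a)" by linarith
    then show "ereal (c / 2) \<le> ereal (birkhoff_sum (\<lambda>w. \<phi> w - min_average \<phi>) n z)"
      using birkhoff_sum_ge_term[OF zD(1) \<open>k < n\<close>] d1(2)[OF d(2) z, unfolded abs_less_iff]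
      by (simp del: One_nat_def)
  qed
  let ?g = "\<lambda>\<epsilon>. Inf (loops x \<epsilon>)"
  have anti: "?g \<epsilon> \<le> ?g \<delta>" if "\<delta> \<le> \<epsilon>" for \<delta> \<epsilon>
    by (rule Inf_superset_mono) (use that in \<open>force simp: mane_ball_def\<close>)
  \<comment> \<open>the infimum grows as \<open>\<epsilon>\<close> decreases, so the limit defining the potential is a supremum\<close>
  have "(?g \<longlongrightarrow> (SUP \<epsilon>\<in>{0<..}. ?g \<epsilon>)) (at_right 0)"
  proof (rule order_tendstoI)
    fix b assume "b < (SUP \<epsilon>\<in>{0<..}. ?g \<epsilon>)"
    then obtain \<epsilon> where "\<epsilon> > 0" "b < ?g \<epsilon>" by (auto simp: less_SUP_iff)
    then show "\<forall>\<^sub>F \<delta> in at_right 0. b < ?g \<delta>"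
      unfolding eventually_at_right_field using anti by (meson less_imp_le less_le_trans)
  next
    fix b assume "(SUP \<epsilon>\<in>{0<..}. ?g \<epsilon>) < b"
    moreover have "?g \<delta> \<le> (SUP \<epsilon>\<in>{0<..}. ?g \<epsilon>)" if "\<delta> > 0" for \<delta>
      using that by (intro SUP_upper) auto
    ultimately show "\<forall>\<^sub>F \<delta> in at_right 0. ?g \<delta> < b"
      by (intro eventually_mono[OF eventually_at_right_less]) (rule le_less_trans)
  qed
  then have "mane_potential \<phi> x x = (SUP \<epsilon>\<in>{0<..}. ?g \<epsilon>)"
    unfolding mane_potential_def by (intro tendsto_Lim) auto
  also have "\<dots> \<ge> ?g d" using d(1) by (intro SUP_upper) auto
  finally have "ereal (c / 2) \<le> mane_potential \<phi> x x" using lower by (rule order_trans[rotated])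
  moreover have "0 < ereal (c / 2)" using c by simp
  ultimately show ?thesis by (rule less_le_trans[rotated])
qed

lemma aubry_set_eq: "aubry_set \<phi> = {fixpt}"
  unfolding aubry_set_def
  using mane_potential_fixpt mane_potential_pos fixpt(1) by (force simp del: One_nat_def)

end

section \<open>Nondegenerate minima\<close>

text \<open>
  The size of \<open>f\<close> in the \<open>C\<^sup>2\<close>-norm, measured by differences.
\<close>

definition second_order_small :: "real \<Rightarrow> (real \<Rightarrow> real) \<Rightarrow> bool" where
  "second_order_small e f \<longleftrightarrow>
     (\<forall>x\<in>{0..1}. \<bar>f x\<bar> \<le> e) \<and>
     (\<forall>x y. 0 \<le> x \<and> x < y \<and> y \<le> 1 \<longrightarrow> \<bar>f y - f x\<bar> \<le> e * (y - x)) \<and>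
     (\<forall>x t. 0 < t \<and> 0 \<le> x - t \<and> x + t \<le> 1 \<longrightarrow> \<bar>f (x + t) + f (x - t) - 2 * f x\<bar> \<le> e * t\<^sup>2)"

text \<open>
  Strict differentiability to second order: first and second difference quotients converge when
  all the points involved tend to \<open>a\<close>. For a \<open>C\<^sup>2\<close> function the limits \<open>L\<close> and \<open>M\<close> are the first and
  second derivative.
\<close>

definition second_order_regular :: "(real \<Rightarrow> real) \<Rightarrow> bool" where
  "second_order_regular f \<longleftrightarrow> (\<forall>a\<in>{0..1}. \<exists>L M. \<forall>e>0. \<exists>d>0.
     (\<forall>x y. 0 \<le> x \<and> x < y \<and> y \<le> 1 \<and> \<bar>x - a\<bar> < d \<and> \<bar>y - a\<bar> < d \<longrightarrow>
        \<bar>f y - f x - L * (y - x)\<bar> \<le> e * (y - x)) \<and>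
     (\<forall>x t. 0 < t \<and> 0 \<le> x - t \<and> x + t \<le> 1 \<and> \<bar>x - t - a\<bar> < d \<and> \<bar>x + t - a\<bar> < d \<longrightarrow>
        \<bar>f (x + t) + f (x - t) - 2 * f x - M * t\<^sup>2\<bar> \<le> e * t\<^sup>2))"

text \<open>
  The first alternative covers a minimum at an end point with nonvanishing derivative, the second one
  a minimum with positive second derivative. The point \<open>a\<close> only locates the minimum: it lies
  within \<open>d\<close> of \<open>a\<close>, and moves under perturbation while \<open>a\<close> can be kept.
\<close>

definition nondegenerate_min :: "(real \<Rightarrow> real) \<Rightarrow> bool" where
  "nondegenerate_min f \<longleftrightarrow> (\<exists>a\<in>{0..1}. \<exists>d>0. \<exists>c>0.
     (\<forall>x\<in>{0..1}. d \<le> \<bar>x - a\<bar> \<longrightarrow> f a + c \<le> f x) \<and>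
     ((\<forall>x y. 0 \<le> x \<and> x < y \<and> y \<le> 1 \<and> \<bar>x - a\<bar> < d \<and> \<bar>y - a\<bar> < d \<longrightarrow>
         c * (y - x) \<le> \<bar>f y - f x\<bar>) \<or>
      (\<forall>x t. 0 < t \<and> 0 \<le> x - t \<and> x + t \<le> 1 \<and> \<bar>x - t - a\<bar> < d \<and> \<bar>x + t - a\<bar> < d \<longrightarrow>
         c * t\<^sup>2 \<le> f (x + t) + f (x - t) - 2 * f x)))"

lemma nondegenerate_min_cong:
  assumes "nondegenerate_min f" "\<And>x. x \<in> {0..1} \<Longrightarrow> f x = g x"
  shows "nondegenerate_min g"
proof -
  obtain a d c where a: "a \<in> {0..1}" and "d > 0" "c > 0"
    and far: "\<And>x. x \<in> {0..1} \<Longrightarrow> d \<le> \<bar>x - a\<bar> \<Longrightarrow> f a + c \<le> f x"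
    and near: "(\<forall>x y. 0 \<le> x \<and> x < y \<and> y \<le> 1 \<and> \<bar>x - a\<bar> < d \<and> \<bar>y - a\<bar> < d \<longrightarrow>
         c * (y - x) \<le> \<bar>f y - f x\<bar>) \<or>
      (\<forall>x t. 0 < t \<and> 0 \<le> x - t \<and> x + t \<le> 1 \<and> \<bar>x - t - a\<bar> < d \<and> \<bar>x + t - a\<bar> < d \<longrightarrow>
         c * t\<^sup>2 \<le> f (x + t) + f (x - t) - 2 * f x)"
    using assms(1) unfolding nondegenerate_min_def by blast
  have "g a + c \<le> g x" if "x \<in> {0..1}" "d \<le> \<bar>x - a\<bar>" for x
    using far[OF that] assms(2)[OF that(1)] assms(2)[OF a] by simp
  moreover have "f x = g x" "f y = g y" if "0 \<le> x" "x < y" "y \<le> 1" for x y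
    using assms(2) that by auto
  moreover have "f x = g x" "f (x + t) = g (x + t)" "f (x - t) = g (x - t)"
    if "0 < t" "0 \<le> x - t" "x + t \<le> 1" for x t
    using assms(2) that by auto
  ultimately show ?thesis
    unfolding nondegenerate_min_def using a \<open>d > 0\<close> \<open>c > 0\<close> near
    by (intro bexI[OF _ a] exI[of _ d] exI[of _ c] conjI) (auto, smt+)
qed

text \<open>
  All minimum points are within \<open>d\<close> of \<open>a\<close>. Two of them are excluded by the first alternative because
  \<open>f\<close> takes the same value there, and by the second one because \<open>f\<close> would be smaller at their
  midpoint.
\<close>

lemma nondegenerate_min_unique:
  assumes "nondegenerate_min f" "continuous_on {0..1} f"
  obtains b where "b \<in> {0..1}" "\<And>x. x \<in> {0..1} \<Longrightarrow> x \<noteq> b \<Longrightarrow> f b < f x"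
proof -
  obtain a d c where a: "a \<in> {0..1}" and "d > 0" "c > 0"
    and far: "\<And>x. x \<in> {0..1} \<Longrightarrow> d \<le> \<bar>x - a\<bar> \<Longrightarrow> f a + c \<le> f x"
    and near: "(\<forall>x y. 0 \<le> x \<and> x < y \<and> y \<le> 1 \<and> \<bar>x - a\<bar> < d \<and> \<bar>y - a\<bar> < d \<longrightarrow>
         c * (y - x) \<le> \<bar>f y - f x\<bar>) \<or>
      (\<forall>x t. 0 < t \<and> 0 \<le> x - t \<and> x + t \<le> 1 \<and> \<bar>x - t - a\<bar> < d \<and> \<bar>x + t - a\<bar> < d \<longrightarrow>
         c * t\<^sup>2 \<le> f (x + t) + f (x - t) - 2 * f x)"
    using assms(1) unfolding nondegenerate_min_def by blast
  obtain b where b: "b \<in> {0..1}" "\<And>x. x \<in> {0..1} \<Longrightarrow> f b \<le> f x"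
    using continuous_attains_inf[OF _ _ assms(2)] by auto
  have close: "\<bar>x - a\<bar> < d" if "x \<in> {0..1}" "f x = f b" for x
    using far[OF that(1)] b(2)[OF a] that(2) \<open>c > 0\<close> by linarith
  have no_pair: False if "x \<in> {0..1}" "y \<in> {0..1}" "x < y" "f x = f b" "f y = f b" for x y
  proof -
    have xy: "0 \<le> x" "y \<le> 1" "\<bar>x - a\<bar> < d" "\<bar>y - a\<bar> < d"
      using that close by auto
    from near show False
    proof
      assume "\<forall>x y. 0 \<le> x \<and> x < y \<and> y \<le> 1 \<and> \<bar>x - a\<bar> < d \<and> \<bar>y - a\<bar> < d \<longrightarrow>
         c * (y - x) \<le> \<bar>f y - f x\<bar>"
      then have "c * (y - x) \<le> \<bar>f y - f x\<bar>" using xy that(3) by blast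
      moreover have "c * (y - x) > 0" using \<open>c > 0\<close> that(3) by simp
      ultimately show False using that(4,5) by simp
    next
      assume *: "\<forall>x t. 0 < t \<and> 0 \<le> x - t \<and> x + t \<le> 1 \<and> \<bar>x - t - a\<bar> < d \<and> \<bar>x + t - a\<bar> < d \<longrightarrow>
         c * t\<^sup>2 \<le> f (x + t) + f (x - t) - 2 * f x"
      define m t where "m = (x + y) / 2" and "t = (y - x) / 2"
      have mt: "m + t = y" "m - t = x" "0 < t" using that(3) by (simp_all add: m_def t_def field_simps)
      then have "c * t\<^sup>2 \<le> f (m + t) + f (m - t) - 2 * f m" using *[rule_format, of t m] xy that(3) by simp
      moreover have "c * t\<^sup>2 > 0" using \<open>c > 0\<close> mt(3) by simp
      moreover have "f b \<le> f m" using xy that(3) by (intro b(2)) (simp add: m_def)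
      ultimately show False using that(4,5) mt(1,2) by simp
    qed
  qed
  show ?thesis
  proof (rule that[OF b(1)])
    fix x assume x: "x \<in> {0..1}" "x \<noteq> b"
    show "f b < f x"
    proof (rule ccontr)
      assume "\<not> f b < f x"
      then have "f x = f b" using b(2)[OF x(1)] by simp
      then show False using no_pair[of x b] no_pair[of b x] x b(1) by linarith
    qed
  qed
qed

lemma nondegenerate_min_stable:
  assumes "nondegenerate_min f"
  obtains e where "e > 0" "\<And>g. second_order_small e g \<Longrightarrow> nondegenerate_min (\<lambda>x. f x + g x)"
proof -
  obtain a d c where a: "a \<in> {0..1}" and "d > 0" "c > 0"
    and far: "\<And>x. x \<in> {0..1} \<Longrightarrow> d \<le> \<bar>x - a\<bar> \<Longrightarrow> f a + c \<le> f x"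
    and near: "(\<forall>x y. 0 \<le> x \<and> x < y \<and> y \<le> 1 \<and> \<bar>x - a\<bar> < d \<and> \<bar>y - a\<bar> < d \<longrightarrow>
         c * (y - x) \<le> \<bar>f y - f x\<bar>) \<or>
      (\<forall>x t. 0 < t \<and> 0 \<le> x - t \<and> x + t \<le> 1 \<and> \<bar>x - t - a\<bar> < d \<and> \<bar>x + t - a\<bar> < d \<longrightarrow>
         c * t\<^sup>2 \<le> f (x + t) + f (x - t) - 2 * f x)"
    using assms(1) unfolding nondegenerate_min_def by blast
  show ?thesis
  proof (rule that[of "c / 4"])
    show "c / 4 > 0" using \<open>c > 0\<close> by simp
    fix g assume "second_order_small (c / 4) g"
    then have g0: "\<And>x. x \<in> {0..1} \<Longrightarrow> \<bar>g x\<bar> \<le> c / 4"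
      and g1: "\<And>x y. 0 \<le> x \<Longrightarrow> x < y \<Longrightarrow> y \<le> 1 \<Longrightarrow> \<bar>g y - g x\<bar> \<le> c / 4 * (y - x)"
      and g2: "\<And>x t. 0 < t \<Longrightarrow> 0 \<le> x - t \<Longrightarrow> x + t \<le> 1 \<Longrightarrow>
                 \<bar>g (x + t) + g (x - t) - 2 * g x\<bar> \<le> c / 4 * t\<^sup>2"
      unfolding second_order_small_def by blast+
    have far': "f a + g a + c / 2 \<le> f x + g x" if "x \<in> {0..1}" "d \<le> \<bar>x - a\<bar>" for x
      using far[OF that] g0[OF that(1)] g0[OF a] unfolding abs_le_iff by linarith
    from near have "(\<forall>x y. 0 \<le> x \<and> x < y \<and> y \<le> 1 \<and> \<bar>x - a\<bar> < d \<and> \<bar>y - a\<bar> < d \<longrightarrow>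
         c / 2 * (y - x) \<le> \<bar>f y + g y - (f x + g x)\<bar>) \<or>
      (\<forall>x t. 0 < t \<and> 0 \<le> x - t \<and> x + t \<le> 1 \<and> \<bar>x - t - a\<bar> < d \<and> \<bar>x + t - a\<bar> < d \<longrightarrow>
         c / 2 * t\<^sup>2 \<le> f (x + t) + g (x + t) + (f (x - t) + g (x - t)) - 2 * (f x + g x))"
    proof (rule disj_forward)
      assume *: "\<forall>x y. 0 \<le> x \<and> x < y \<and> y \<le> 1 \<and> \<bar>x - a\<bar> < d \<and> \<bar>y - a\<bar> < d \<longrightarrow>
         c * (y - x) \<le> \<bar>f y - f x\<bar>"
      show "\<forall>x y. 0 \<le> x \<and> x < y \<and> y \<le> 1 \<and> \<bar>x - a\<bar> < d \<and> \<bar>y - a\<bar> < d \<longrightarrow>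
         c / 2 * (y - x) \<le> \<bar>f y + g y - (f x + g x)\<bar>"
      proof (intro allI impI, elim conjE)
        fix x y assume xy: "0 \<le> x" "x < y" "y \<le> 1" "\<bar>x - a\<bar> < d" "\<bar>y - a\<bar> < d"
        have "c * (y - x) \<le> \<bar>f y - f x\<bar>" using * xy by blast
        moreover have "\<bar>g y - g x\<bar> \<le> c / 4 * (y - x)" using g1 xy by blast
        moreover have "0 \<le> c / 4 * (y - x)" using \<open>c > 0\<close> xy by simp
        moreover have "\<bar>f y - f x\<bar> \<le> \<bar>f y + g y - (f x + g x)\<bar> + \<bar>g y - g x\<bar>" by arith
        ultimately show "c / 2 * (y - x) \<le> \<bar>f y + g y - (f x + g x)\<bar>" by linarith
      qed
    next
      assume *: "\<forall>x t. 0 < t \<and> 0 \<le> x - t \<and> x + t \<le> 1 \<and> \<bar>x - t - a\<bar> < d \<and> \<bar>x + t - a\<bar> < d \<longrightarrow>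
         c * t\<^sup>2 \<le> f (x + t) + f (x - t) - 2 * f x"
      show "\<forall>x t. 0 < t \<and> 0 \<le> x - t \<and> x + t \<le> 1 \<and> \<bar>x - t - a\<bar> < d \<and> \<bar>x + t - a\<bar> < d \<longrightarrow>
         c / 2 * t\<^sup>2 \<le> f (x + t) + g (x + t) + (f (x - t) + g (x - t)) - 2 * (f x + g x)"
      proof (intro allI impI, elim conjE)
        fix x t assume xt: "0 < t" "0 \<le> x - t" "x + t \<le> 1" "\<bar>x - t - a\<bar> < d" "\<bar>x + t - a\<bar> < d"
        have "c * t\<^sup>2 \<le> f (x + t) + f (x - t) - 2 * f x" using * xt by blast
        moreover have "- (g (x + t) + g (x - t) - 2 * g x) \<le> c / 4 * t\<^sup>2"
          using g2[OF xt(1-3)] unfolding abs_le_iff by blast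
        moreover have "0 \<le> c / 4 * t\<^sup>2" using \<open>c > 0\<close> by simp
        ultimately show "c / 2 * t\<^sup>2 \<le> f (x + t) + g (x + t) + (f (x - t) + g (x - t)) - 2 * (f x + g x)"
          by argo
      qed
    qed
    then show "nondegenerate_min (\<lambda>x. f x + g x)"
      unfolding nondegenerate_min_def
      by (intro bexI[OF _ a] exI[of _ d] exI[of _ "c / 2"] conjI) (use \<open>d > 0\<close> \<open>c > 0\<close> far' in auto)
  qed
qed

text \<open>
  At an interior minimum the limit \<open>M\<close> of second difference quotients is nonnegative, and \<open>(x - a)\<^sup>2\<close>
  makes it positive. At an end point the limit \<open>L\<close> of difference quotients, taken in the inward direction, is
  nonnegative, and the term \<open>s * (x - a) = \<bar>x - a\<bar>\<close> makes it nonzero; \<open>(x - a)\<^sup>2\<close> is harmless there.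
\<close>

lemma nondegenerate_min_perturbation:
  assumes reg: "second_order_regular f" and a: "a \<in> {0..1}" and min: "\<And>x. x \<in> {0..1} \<Longrightarrow> f a \<le> f x"
  obtains q :: "real poly" where "\<And>\<eta>. \<eta> > 0 \<Longrightarrow> nondegenerate_min (\<lambda>x. f x + \<eta> * poly q x)"
proof -
  define s where "s = (if a = 0 then 1 else if a = 1 then -1 else 0 :: real)"
  define q where "q = [:-a, 1:]\<^sup>2 + smult s [:-a, 1:]"
  have q: "poly q x = (x - a)\<^sup>2 + s * (x - a)" for x
    by (simp add: q_def power2_eq_square algebra_simps)
  have s_nonneg: "0 \<le> s * (x - a)" if "x \<in> {0..1}" for x
    using that by (auto simp: s_def)
  obtain L M where LM: "\<And>e. e > 0 \<Longrightarrow> \<exists>d>0.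
     (\<forall>x y. 0 \<le> x \<and> x < y \<and> y \<le> 1 \<and> \<bar>x - a\<bar> < d \<and> \<bar>y - a\<bar> < d \<longrightarrow>
        \<bar>f y - f x - L * (y - x)\<bar> \<le> e * (y - x)) \<and>
     (\<forall>x t. 0 < t \<and> 0 \<le> x - t \<and> x + t \<le> 1 \<and> \<bar>x - t - a\<bar> < d \<and> \<bar>x + t - a\<bar> < d \<longrightarrow>
        \<bar>f (x + t) + f (x - t) - 2 * f x - M * t\<^sup>2\<bar> \<le> e * t\<^sup>2)"
    using reg a unfolding second_order_regular_def by blast
  show ?thesis
  proof (rule that[of q])
    fix \<eta> :: real assume \<eta>: "\<eta> > 0"
    obtain d where d: "d > 0"
      and d1: "\<And>x y. 0 \<le> x \<Longrightarrow> x < y \<Longrightarrow> y \<le> 1 \<Longrightarrow> \<bar>x - a\<bar> < d \<Longrightarrow> \<bar>y - a\<bar> < d \<Longrightarrow>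
        \<bar>f y - f x - L * (y - x)\<bar> \<le> \<eta> / 4 * (y - x)"
      and d2: "\<And>x t. 0 < t \<Longrightarrow> 0 \<le> x - t \<Longrightarrow> x + t \<le> 1 \<Longrightarrow> \<bar>x - t - a\<bar> < d \<Longrightarrow> \<bar>x + t - a\<bar> < d \<Longrightarrow>
        \<bar>f (x + t) + f (x - t) - 2 * f x - M * t\<^sup>2\<bar> \<le> \<eta> / 4 * t\<^sup>2"
      using LM[of "\<eta> / 4"] \<eta> by (auto simp del: abs_divide times_divide_eq_left)
    define c where "c = min (\<eta> / 4) (\<eta> * d\<^sup>2)"
    have c: "c > 0" "c \<le> \<eta> / 4" "c \<le> \<eta> * d\<^sup>2" using \<eta> d by (auto simp: c_def)
    have far: "f a + \<eta> * poly q a + c \<le> f x + \<eta> * poly q x" if "x \<in> {0..1}" "d \<le> \<bar>x - a\<bar>" for x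
    proof -
      have "d\<^sup>2 \<le> (x - a)\<^sup>2" using that(2) d by (metis abs_le_square_iff abs_of_pos)
      then have "d\<^sup>2 \<le> poly q x" using s_nonneg[OF that(1)] by (simp add: q)
      then have "\<eta> * d\<^sup>2 \<le> \<eta> * poly q x" using \<eta> by simp
      then show ?thesis using min[OF that(1)] c(3) by (simp add: q)
    qed
    have near: "(\<forall>x y. 0 \<le> x \<and> x < y \<and> y \<le> 1 \<and> \<bar>x - a\<bar> < d \<and> \<bar>y - a\<bar> < d \<longrightarrow>
         c * (y - x) \<le> \<bar>f y + \<eta> * poly q y - (f x + \<eta> * poly q x)\<bar>) \<or>
      (\<forall>x t. 0 < t \<and> 0 \<le> x - t \<and> x + t \<le> 1 \<and> \<bar>x - t - a\<bar> < d \<and> \<bar>x + t - a\<bar> < d \<longrightarrow>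
         c * t\<^sup>2 \<le> f (x + t) + \<eta> * poly q (x + t) + (f (x - t) + \<eta> * poly q (x - t))
                    - 2 * (f x + \<eta> * poly q x))"
    proof (cases "a = 0 \<or> a = 1")
      case True
      then have s: "s * s = 1" "s = 1 - 2 * a" by (auto simp: s_def)
      \<comment> \<open>a comparison point strictly inside the interval, to find the sign of \<open>L\<close>\<close>
      define b where "b = a + s * (Min {d, 1} / 2)"
      have b: "b \<in> {0..1}" "\<bar>b - a\<bar> < d" "s * (b - a) > 0"
        using True d by (auto simp: b_def s_def min_def)
      have L: "- (\<eta> / 4) \<le> s * L"
      proof -
        have fb: "f a \<le> f b" by (rule min[OF b(1)])
        from True show ?thesis
        proof
          assume a0: "a = 0"
          then have "0 < b" using b by (simp add: s_def)
          then have "\<bar>f b - f 0 - L * (b - 0)\<bar> \<le> \<eta> / 4 * (b - 0)" using d1[of 0 b] b a0 d by simp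
          then have "f b - f 0 - L * b \<le> \<eta> / 4 * b" by (simp only: abs_le_iff diff_zero)
          then have "0 \<le> (L + \<eta> / 4) * b" using fb a0 by (simp add: algebra_simps)
          then show ?thesis using \<open>0 < b\<close> a0 by (simp add: zero_le_mult_iff s_def)
        next
          assume a1: "a = 1"
          then have "b < 1" using b by (simp add: s_def)
          then have "\<bar>f 1 - f b - L * (1 - b)\<bar> \<le> \<eta> / 4 * (1 - b)" using d1[of b 1] b a1 d by simp
          then have "- (f 1 - f b - L * (1 - b)) \<le> \<eta> / 4 * (1 - b)" by (simp only: abs_le_iff)
          then have "0 \<le> (\<eta> / 4 - L) * (1 - b)" using fb a1 by (simp add: field_simps)
          then show ?thesis using \<open>b < 1\<close> a1 by (simp add: zero_le_mult_iff s_def)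
        qed
      qed
      have "c * (y - x) \<le> \<bar>f y + \<eta> * poly q y - (f x + \<eta> * poly q x)\<bar>"
        if xy: "0 \<le> x" "x < y" "y \<le> 1" "\<bar>x - a\<bar> < d" "\<bar>y - a\<bar> < d" for x y
      proof -
        have "- (\<eta> / 4 * (y - x)) \<le> s * (f y - f x - L * (y - x))"
        proof -
          have "s = 1 \<or> s = - 1" using True by (auto simp: s_def)
          moreover have "f y - f x - L * (y - x) \<le> \<eta> / 4 * (y - x)"
            "- (f y - f x - L * (y - x)) \<le> \<eta> / 4 * (y - x)"
            using d1[OF xy] by (simp_all only: abs_le_iff)
          ultimately show ?thesis
            by (elim disjE) (simp_all add: field_simps)
        qed
        moreover have "- (\<eta> / 4) * (y - x) \<le> s * L * (y - x)"
          using L xy by (intro mult_right_mono) auto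
        moreover have "y - x \<le> s * (poly q y - poly q x)"
        proof -
          have "s * (poly q y - poly q x) = (s * s) * (y - x) + s * ((y - a) + (x - a)) * (y - x)"
            by (simp add: q power2_eq_square algebra_simps)
          then have "s * (poly q y - poly q x) = (y - x) + s * ((y - a) + (x - a)) * (y - x)"
            by (simp add: s(1))
          moreover have "0 \<le> s * (y - a) + s * (x - a)"
            using s_nonneg[of x] s_nonneg[of y] xy by simp
          then have "0 \<le> s * ((y - a) + (x - a))" by (simp only: distrib_left)
          then have "0 \<le> s * ((y - a) + (x - a)) * (y - x)"
            by (rule mult_nonneg_nonneg) (use xy in simp)
          ultimately show ?thesis by linarith
        qed
        then have "\<eta> * (y - x) \<le> \<eta> * (s * (poly q y - poly q x))" using \<eta> by simp
        ultimately have "\<eta> / 2 * (y - x) \<le> s * (f y + \<eta> * poly q y - (f x + \<eta> * poly q x))"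
          by (simp add: field_simps)
        also have "\<dots> \<le> \<bar>f y + \<eta> * poly q y - (f x + \<eta> * poly q x)\<bar>"
          using True by (auto simp: s_def)
        finally have "\<eta> / 2 * (y - x) \<le> \<bar>f y + \<eta> * poly q y - (f x + \<eta> * poly q x)\<bar>" .
        moreover have "c * (y - x) \<le> \<eta> / 2 * (y - x)" using c \<eta> xy by (intro mult_right_mono) auto
        ultimately show ?thesis by linarith
      qed
      then show ?thesis by blast
    next
      case False
      then have s: "s = 0" and a': "0 < a" "a < 1" using a by (auto simp: s_def)
      \<comment> \<open>a symmetric second difference around the minimum itself shows \<open>M \<ge> 0\<close> up to an error\<close>
      define \<tau> where "\<tau> = Min {d, a, 1 - a} / 2"
      have "Min {d, a, 1 - a} > 0" "Min {d, a, 1 - a} \<le> d" "Min {d, a, 1 - a} \<le> a"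
        "Min {d, a, 1 - a} \<le> 1 - a" using d a' by auto
      then have \<tau>: "0 < \<tau>" "0 \<le> a - \<tau>" "a + \<tau> \<le> 1" "\<tau> < d"
        by (auto simp: \<tau>_def)
      have "f (a + \<tau>) + f (a - \<tau>) - 2 * f a - M * \<tau>\<^sup>2 \<le> \<eta> / 4 * \<tau>\<^sup>2"
        by (rule abs_le_D1, rule d2) (use \<tau> in auto)
      moreover have "f a \<le> f (a + \<tau>)" "f a \<le> f (a - \<tau>)" using \<tau> by (auto intro!: min)
      ultimately have "0 \<le> (M + \<eta> / 4) * \<tau>\<^sup>2" by (simp add: field_simps)
      then have M: "- (\<eta> / 4) \<le> M" using \<tau> by (simp add: zero_le_mult_iff)
      have "c * t\<^sup>2 \<le> f (x + t) + \<eta> * poly q (x + t) + (f (x - t) + \<eta> * poly q (x - t))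
                    - 2 * (f x + \<eta> * poly q x)"
        if xt: "0 < t" "0 \<le> x - t" "x + t \<le> 1" "\<bar>x - t - a\<bar> < d" "\<bar>x + t - a\<bar> < d" for x t
      proof -
        have "- (\<eta> / 4 * t\<^sup>2) \<le> f (x + t) + f (x - t) - 2 * f x - M * t\<^sup>2"
          using abs_le_D2[OF d2[OF xt]] by linarith
        moreover have "- (\<eta> / 4) * t\<^sup>2 \<le> M * t\<^sup>2" using M by (intro mult_right_mono) auto
        moreover have "poly q (x + t) + poly q (x - t) - 2 * poly q x = 2 * t\<^sup>2"
          by (simp add: q s power2_eq_square algebra_simps)
        then have "\<eta> * poly q (x + t) + \<eta> * poly q (x - t) - 2 * (\<eta> * poly q x) = 2 * \<eta> * t\<^sup>2"
          by algebra
        moreover have "c * t\<^sup>2 \<le> \<eta> / 4 * t\<^sup>2" using c by (intro mult_right_mono) auto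
        moreover have "0 \<le> \<eta> * t\<^sup>2" using \<eta> by simp
        ultimately show ?thesis by argo
      qed
      then show ?thesis by blast
    qed
    show "nondegenerate_min (\<lambda>x. f x + \<eta> * poly q x)"
      unfolding nondegenerate_min_def
      by (intro bexI[OF _ a] exI[of _ d] exI[of _ c] conjI) (use d c far near in auto)
  qed
qed

section \<open>Second order differences of smooth functions\<close>

lemma continuous_on_square_near:
  assumes "continuous_on unit_square q" "a \<in> {0..1}" "e > 0"
  obtains d where "d > 0" "\<And>x y. x \<in> {0..1} \<Longrightarrow> y \<in> {0..1} \<Longrightarrow> \<bar>x - a\<bar> < d \<Longrightarrow> \<bar>y - a\<bar> < d \<Longrightarrow>
    \<bar>q (x, y) - q (a, a)\<bar> < (e :: real)"
proof -
  obtain d where d: "d > 0" "\<And>p. p \<in> unit_square \<Longrightarrow> dist p (a, a) < d \<Longrightarrow> dist (q p) (q (a, a)) < e"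
  proof -
    have "(a, a) \<in> unit_square" using assms(2) by simp
    then show ?thesis using that assms(1,3) unfolding continuous_on_iff by blast
  qed
  show ?thesis
  proof (rule that[of "d / 2"])
    fix x y assume "x \<in> {0..1}" "y \<in> {0..1}" "\<bar>x - a\<bar> < d / 2" "\<bar>y - a\<bar> < d / 2"
    moreover have "dist (x, y) (a, a) \<le> \<bar>x - a\<bar> + \<bar>y - a\<bar>"
      using sqrt_sum_squares_le_sum_abs[of "x - a" "y - a"] by (simp add: dist_Pair_Pair dist_real_def)
    ultimately have "dist (q (x, y)) (q (a, a)) < e" by (intro d(2)) auto
    then show "\<bar>q (x, y) - q (a, a)\<bar> < e" by (simp add: dist_real_def)
  qed (use d in simp)
qed

text \<open>
  The mean value formulas express the difference quotients as derivatives at nearby points, which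
  are close to their values at \<open>(a, a)\<close> by continuity.
\<close>

lemma second_order_regular_diagonal:
  assumes g: "Cr_differentiable_sq 2 g"
  shows "second_order_regular (\<lambda>x. g (x, x))"
  unfolding second_order_regular_def
proof
  fix a :: real assume a: "a \<in> {0..1}"
  have cont: "continuous_on unit_square (D1 g)" "continuous_on unit_square (D2 g)"
    "continuous_on unit_square (D1 (D1 g))" "continuous_on unit_square (D2 (D1 g))"
    "continuous_on unit_square (D2 (D2 g))"
    using g by (auto simp: numeral_2_eq_2)
  let ?L = "D1 g (a, a) + D2 g (a, a)"
  let ?M = "D2 (D1 g) (a, a) + D2 (D1 g) (a, a) + D1 (D1 g) (a, a) + D2 (D2 g) (a, a)"
  show "\<exists>L M. \<forall>e>0. \<exists>d>0.
     (\<forall>x y. 0 \<le> x \<and> x < y \<and> y \<le> 1 \<and> \<bar>x - a\<bar> < d \<and> \<bar>y - a\<bar> < d \<longrightarrow>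
        \<bar>g (y, y) - g (x, x) - L * (y - x)\<bar> \<le> e * (y - x)) \<and>
     (\<forall>x t. 0 < t \<and> 0 \<le> x - t \<and> x + t \<le> 1 \<and> \<bar>x - t - a\<bar> < d \<and> \<bar>x + t - a\<bar> < d \<longrightarrow>
        \<bar>g (x + t, x + t) + g (x - t, x - t) - 2 * g (x, x) - M * t\<^sup>2\<bar> \<le> e * t\<^sup>2)"
  proof (rule exI[of _ ?L], rule exI[of _ ?M], intro allI impI)
    fix e :: real assume "e > 0"
    then have e: "e / 4 > 0" by simp
    obtain d1 where d1: "d1 > 0" "\<And>x y. x \<in> {0..1} \<Longrightarrow> y \<in> {0..1} \<Longrightarrow> \<bar>x - a\<bar> < d1 \<Longrightarrow> \<bar>y - a\<bar> < d1 \<Longrightarrow>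
      \<bar>D1 g (x, y) - D1 g (a, a)\<bar> < e / 4" using continuous_on_square_near[OF cont(1) a e] by blast
    obtain d2 where d2: "d2 > 0" "\<And>x y. x \<in> {0..1} \<Longrightarrow> y \<in> {0..1} \<Longrightarrow> \<bar>x - a\<bar> < d2 \<Longrightarrow> \<bar>y - a\<bar> < d2 \<Longrightarrow>
      \<bar>D2 g (x, y) - D2 g (a, a)\<bar> < e / 4" using continuous_on_square_near[OF cont(2) a e] by blast
    obtain d3 where d3: "d3 > 0" "\<And>x y. x \<in> {0..1} \<Longrightarrow> y \<in> {0..1} \<Longrightarrow> \<bar>x - a\<bar> < d3 \<Longrightarrow> \<bar>y - a\<bar> < d3 \<Longrightarrow>
      \<bar>D1 (D1 g) (x, y) - D1 (D1 g) (a, a)\<bar> < e / 4" using continuous_on_square_near[OF cont(3) a e] by blast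
    obtain d4 where d4: "d4 > 0" "\<And>x y. x \<in> {0..1} \<Longrightarrow> y \<in> {0..1} \<Longrightarrow> \<bar>x - a\<bar> < d4 \<Longrightarrow> \<bar>y - a\<bar> < d4 \<Longrightarrow>
      \<bar>D2 (D1 g) (x, y) - D2 (D1 g) (a, a)\<bar> < e / 4" using continuous_on_square_near[OF cont(4) a e] by blast
    obtain d5 where d5: "d5 > 0" "\<And>x y. x \<in> {0..1} \<Longrightarrow> y \<in> {0..1} \<Longrightarrow> \<bar>x - a\<bar> < d5 \<Longrightarrow> \<bar>y - a\<bar> < d5 \<Longrightarrow>
      \<bar>D2 (D2 g) (x, y) - D2 (D2 g) (a, a)\<bar> < e / 4" using continuous_on_square_near[OF cont(5) a e] by blast
    define d where "d = Min {d1, d2, d3, d4, d5}"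
    have d: "d > 0" "d \<le> d1" "d \<le> d2" "d \<le> d3" "d \<le> d4" "d \<le> d5"
      using d1(1) d2(1) d3(1) d4(1) d5(1) by (auto simp: d_def)
    have first: "\<bar>g (y, y) - g (x, x) - ?L * (y - x)\<bar> \<le> e * (y - x)"
      if xy: "0 \<le> x" "x < y" "y \<le> 1" "\<bar>x - a\<bar> < d" "\<bar>y - a\<bar> < d" for x y
    proof -
      obtain \<xi> \<zeta> where m: "x < \<xi>" "\<xi> < y" "x < \<zeta>" "\<zeta> < y"
        "g (y, y) - g (x, x) = (D1 g (\<xi>, y) + D2 g (x, \<zeta>)) * (y - x)"
        using diagonal_difference_mean[OF g xy(1-3)] by blast
      have "\<bar>\<xi> - a\<bar> < d" "\<bar>\<zeta> - a\<bar> < d" using m xy by auto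
      then have "\<bar>D1 g (\<xi>, y) - D1 g (a, a)\<bar> < e / 4" "\<bar>D2 g (x, \<zeta>) - D2 g (a, a)\<bar> < e / 4"
        by (intro d1(2) d2(2); use m xy d in simp)+
      then have "\<bar>D1 g (\<xi>, y) + D2 g (x, \<zeta>) - ?L\<bar> \<le> e" using \<open>e > 0\<close> by linarith
      then have "\<bar>D1 g (\<xi>, y) + D2 g (x, \<zeta>) - ?L\<bar> * (y - x) \<le> e * (y - x)"
        using xy by (intro mult_right_mono) auto
      also have "\<bar>D1 g (\<xi>, y) + D2 g (x, \<zeta>) - ?L\<bar> * (y - x) = \<bar>(D1 g (\<xi>, y) + D2 g (x, \<zeta>) - ?L) * (y - x)\<bar>"
        using xy by (simp add: abs_mult)
      also have "(D1 g (\<xi>, y) + D2 g (x, \<zeta>) - ?L) * (y - x) = g (y, y) - g (x, x) - ?L * (y - x)"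
        unfolding m(5) by (rule left_diff_distrib)
      finally show ?thesis .
    qed
    have second: "\<bar>g (x + t, x + t) + g (x - t, x - t) - 2 * g (x, x) - ?M * t\<^sup>2\<bar> \<le> e * t\<^sup>2"
      if xt: "0 < t" "0 \<le> x - t" "x + t \<le> 1" "\<bar>x - t - a\<bar> < d" "\<bar>x + t - a\<bar> < d" for x t
    proof -
      obtain p q v w where m: "p \<in> {x-t<..<x+t} \<times> {x-t<..<x+t}" "q \<in> {x-t<..<x+t} \<times> {x-t<..<x+t}"
        "v \<in> {x-t<..<x+t}" "w \<in> {x-t<..<x+t}"
        "g (x + t, x + t) + g (x - t, x - t) - 2 * g (x, x) =
           (D2 (D1 g) p + D2 (D1 g) q + D1 (D1 g) (v, x) + D2 (D2 g) (x, w)) * t\<^sup>2"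
        using diagonal_second_difference_mean[OF g xt(1-3)] by blast
      have near: "z \<in> {0..1}" "\<bar>z - a\<bar> < d" if "z \<in> {x-t<..<x+t}" for z
        using that xt by auto
      have x: "x \<in> {x-t<..<x+t}" using xt by simp
      have "\<bar>D2 (D1 g) k - D2 (D1 g) (a, a)\<bar> < e / 4" if "k \<in> {x-t<..<x+t} \<times> {x-t<..<x+t}" for k
        using that
      proof (cases k)
        case (Pair k1 k2)
        then have "k1 \<in> {x-t<..<x+t}" "k2 \<in> {x-t<..<x+t}" using that by auto
        then show ?thesis
          using d4(2)[of k1 k2] near[of k1] near[of k2] d(5) by (simp add: Pair)
      qed
      then have "\<bar>D2 (D1 g) p - D2 (D1 g) (a, a)\<bar> < e / 4" "\<bar>D2 (D1 g) q - D2 (D1 g) (a, a)\<bar> < e / 4"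
        using m(1,2) by blast+
      moreover have "\<bar>D1 (D1 g) (v, x) - D1 (D1 g) (a, a)\<bar> < e / 4" "\<bar>D2 (D2 g) (x, w) - D2 (D2 g) (a, a)\<bar> < e / 4"
        using d3(2)[of v x] d5(2)[of x w] near[OF m(3)] near[OF m(4)] near[OF x] d by auto
      ultimately have "\<bar>D2 (D1 g) p + D2 (D1 g) q + D1 (D1 g) (v, x) + D2 (D2 g) (x, w) - ?M\<bar> \<le> e"
        by linarith
      then have "\<bar>D2 (D1 g) p + D2 (D1 g) q + D1 (D1 g) (v, x) + D2 (D2 g) (x, w) - ?M\<bar> * t\<^sup>2 \<le> e * t\<^sup>2"
        by (intro mult_right_mono) auto
      also have "\<bar>D2 (D1 g) p + D2 (D1 g) q + D1 (D1 g) (v, x) + D2 (D2 g) (x, w) - ?M\<bar> * t\<^sup>2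
          = \<bar>(D2 (D1 g) p + D2 (D1 g) q + D1 (D1 g) (v, x) + D2 (D2 g) (x, w) - ?M) * t\<^sup>2\<bar>"
        by (simp add: abs_mult)
      also have "(D2 (D1 g) p + D2 (D1 g) q + D1 (D1 g) (v, x) + D2 (D2 g) (x, w) - ?M) * t\<^sup>2
          = g (x + t, x + t) + g (x - t, x - t) - 2 * g (x, x) - ?M * t\<^sup>2"
        unfolding m(5) by (rule left_diff_distrib)
      finally show ?thesis .
    qed
    show "\<exists>d>0. (\<forall>x y. 0 \<le> x \<and> x < y \<and> y \<le> 1 \<and> \<bar>x - a\<bar> < d \<and> \<bar>y - a\<bar> < d \<longrightarrow>
        \<bar>g (y, y) - g (x, x) - ?L * (y - x)\<bar> \<le> e * (y - x)) \<and>
     (\<forall>x t. 0 < t \<and> 0 \<le> x - t \<and> x + t \<le> 1 \<and> \<bar>x - t - a\<bar> < d \<and> \<bar>x + t - a\<bar> < d \<longrightarrow>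
        \<bar>g (x + t, x + t) + g (x - t, x - t) - 2 * g (x, x) - ?M * t\<^sup>2\<bar> \<le> e * t\<^sup>2)"
      using d(1) first second by blast
  qed
qed

lemma deriv_I_difference_mean:
  assumes "Cr_differentiable_I 2 V" "0 \<le> x" "x < y" "y \<le> 1"
  obtains \<xi> where "x < \<xi>" "\<xi> < y" "V y - V x = deriv_I V \<xi> * (y - x)"
  by (rule unit_interval_mvt[of V "deriv_I V" x y])
     (use assms in \<open>auto intro: deriv_I_derivative[of 1] simp: numeral_2_eq_2\<close>)

lemma deriv_I_second_difference_mean:
  assumes V: "Cr_differentiable_I 2 V" and t: "0 < t" "0 \<le> x - t" "x + t \<le> 1"
  obtains z where "x - t < z" "z < x + t"
    "V (x + t) + V (x - t) - 2 * V x = deriv_I (deriv_I V) z * t\<^sup>2"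
proof -
  have "Cr_differentiable_I (Suc 1) V" "Cr_differentiable_I (Suc 0) (deriv_I V)"
    using V by (simp_all add: numeral_2_eq_2)
  then show ?thesis
    using second_difference_mean[of V "deriv_I V" "deriv_I (deriv_I V)" t x] t that
    by (blast intro: deriv_I_derivative)
qed

lemma second_order_regular_interval:
  assumes V: "Cr_differentiable_I 2 V"
  shows "second_order_regular V"
  unfolding second_order_regular_def
proof
  fix a :: real assume a: "a \<in> {0..1}"
  have cont: "continuous_on {0..1} (deriv_I V)" "continuous_on {0..1} (deriv_I (deriv_I V))"
    using V by (auto simp: numeral_2_eq_2)
  let ?L = "deriv_I V a" and ?M = "deriv_I (deriv_I V) a"
  show "\<exists>L M. \<forall>e>0. \<exists>d>0.
     (\<forall>x y. 0 \<le> x \<and> x < y \<and> y \<le> 1 \<and> \<bar>x - a\<bar> < d \<and> \<bar>y - a\<bar> < d \<longrightarrow>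
        \<bar>V y - V x - L * (y - x)\<bar> \<le> e * (y - x)) \<and>
     (\<forall>x t. 0 < t \<and> 0 \<le> x - t \<and> x + t \<le> 1 \<and> \<bar>x - t - a\<bar> < d \<and> \<bar>x + t - a\<bar> < d \<longrightarrow>
        \<bar>V (x + t) + V (x - t) - 2 * V x - M * t\<^sup>2\<bar> \<le> e * t\<^sup>2)"
  proof (rule exI[of _ ?L], rule exI[of _ ?M], intro allI impI)
    fix e :: real assume e: "e > 0"
    obtain d1 where d1: "d1 > 0" "\<And>x. x \<in> {0..1} \<Longrightarrow> \<bar>x - a\<bar> < d1 \<Longrightarrow> \<bar>deriv_I V x - ?L\<bar> < e"
      using cont(1) a e unfolding continuous_on_iff dist_real_def by meson
    obtain d2 where d2: "d2 > 0" "\<And>x. x \<in> {0..1} \<Longrightarrow> \<bar>x - a\<bar> < d2 \<Longrightarrow> \<bar>deriv_I (deriv_I V) x - ?M\<bar> < e"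
      using cont(2) a e unfolding continuous_on_iff dist_real_def by meson
    define d where "d = min d1 d2"
    have d: "d > 0" "d \<le> d1" "d \<le> d2" using d1(1) d2(1) by (auto simp: d_def)
    have first: "\<bar>V y - V x - ?L * (y - x)\<bar> \<le> e * (y - x)"
      if xy: "0 \<le> x" "x < y" "y \<le> 1" "\<bar>x - a\<bar> < d" "\<bar>y - a\<bar> < d" for x y
    proof -
      obtain \<xi> where m: "x < \<xi>" "\<xi> < y" "V y - V x = deriv_I V \<xi> * (y - x)"
        using deriv_I_difference_mean[OF V xy(1-3)] by blast
      have "\<bar>deriv_I V \<xi> - ?L\<bar> < e" using m xy d by (intro d1(2)) auto
      then have "\<bar>deriv_I V \<xi> - ?L\<bar> * (y - x) \<le> e * (y - x)"
        using xy by (intro mult_right_mono) auto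
      also have "\<bar>deriv_I V \<xi> - ?L\<bar> * (y - x) = \<bar>(deriv_I V \<xi> - ?L) * (y - x)\<bar>"
        using xy by (simp add: abs_mult)
      also have "(deriv_I V \<xi> - ?L) * (y - x) = V y - V x - ?L * (y - x)"
        unfolding m(3) by (rule left_diff_distrib)
      finally show ?thesis .
    qed
    have second: "\<bar>V (x + t) + V (x - t) - 2 * V x - ?M * t\<^sup>2\<bar> \<le> e * t\<^sup>2"
      if xt: "0 < t" "0 \<le> x - t" "x + t \<le> 1" "\<bar>x - t - a\<bar> < d" "\<bar>x + t - a\<bar> < d" for x t
    proof -
      obtain z where m: "x - t < z" "z < x + t"
        "V (x + t) + V (x - t) - 2 * V x = deriv_I (deriv_I V) z * t\<^sup>2"
        using deriv_I_second_difference_mean[OF V xt(1-3)] by blast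
      have "\<bar>deriv_I (deriv_I V) z - ?M\<bar> < e" using m xt d by (intro d2(2)) auto
      then have "\<bar>deriv_I (deriv_I V) z - ?M\<bar> * t\<^sup>2 \<le> e * t\<^sup>2"
        by (intro mult_right_mono) auto
      also have "\<bar>deriv_I (deriv_I V) z - ?M\<bar> * t\<^sup>2 = \<bar>(deriv_I (deriv_I V) z - ?M) * t\<^sup>2\<bar>"
        by (simp add: abs_mult)
      also have "(deriv_I (deriv_I V) z - ?M) * t\<^sup>2 = V (x + t) + V (x - t) - 2 * V x - ?M * t\<^sup>2"
        unfolding m(3) by (rule left_diff_distrib)
      finally show ?thesis .
    qed
    show "\<exists>d>0. (\<forall>x y. 0 \<le> x \<and> x < y \<and> y \<le> 1 \<and> \<bar>x - a\<bar> < d \<and> \<bar>y - a\<bar> < d \<longrightarrow>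
        \<bar>V y - V x - ?L * (y - x)\<bar> \<le> e * (y - x)) \<and>
     (\<forall>x t. 0 < t \<and> 0 \<le> x - t \<and> x + t \<le> 1 \<and> \<bar>x - t - a\<bar> < d \<and> \<bar>x + t - a\<bar> < d \<longrightarrow>
        \<bar>V (x + t) + V (x - t) - 2 * V x - ?M * t\<^sup>2\<bar> \<le> e * t\<^sup>2)"
      using d(1) first second by blast
  qed
qed

lemma second_order_regular_add:
  assumes "second_order_regular f" "second_order_regular g"
  shows "second_order_regular (\<lambda>x. f x + g x)"
  unfolding second_order_regular_def
proof
  fix a :: real assume a: "a \<in> {0..1}"
  obtain L M where f: "\<And>e. e > 0 \<Longrightarrow> \<exists>d>0.
     (\<forall>x y. 0 \<le> x \<and> x < y \<and> y \<le> 1 \<and> \<bar>x - a\<bar> < d \<and> \<bar>y - a\<bar> < d \<longrightarrow>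
        \<bar>f y - f x - L * (y - x)\<bar> \<le> e * (y - x)) \<and>
     (\<forall>x t. 0 < t \<and> 0 \<le> x - t \<and> x + t \<le> 1 \<and> \<bar>x - t - a\<bar> < d \<and> \<bar>x + t - a\<bar> < d \<longrightarrow>
        \<bar>f (x + t) + f (x - t) - 2 * f x - M * t\<^sup>2\<bar> \<le> e * t\<^sup>2)"
    using assms(1) a unfolding second_order_regular_def by blast
  obtain L' M' where g: "\<And>e. e > 0 \<Longrightarrow> \<exists>d>0.
     (\<forall>x y. 0 \<le> x \<and> x < y \<and> y \<le> 1 \<and> \<bar>x - a\<bar> < d \<and> \<bar>y - a\<bar> < d \<longrightarrow>
        \<bar>g y - g x - L' * (y - x)\<bar> \<le> e * (y - x)) \<and>
     (\<forall>x t. 0 < t \<and> 0 \<le> x - t \<and> x + t \<le> 1 \<and> \<bar>x - t - a\<bar> < d \<and> \<bar>x + t - a\<bar> < d \<longrightarrow>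
        \<bar>g (x + t) + g (x - t) - 2 * g x - M' * t\<^sup>2\<bar> \<le> e * t\<^sup>2)"
    using assms(2) a unfolding second_order_regular_def by blast
  have triangle: "\<bar>p + q - (r + s)\<bar> \<le> b" if "\<bar>p - r\<bar> \<le> b / 2" "\<bar>q - s\<bar> \<le> b / 2" for p q r s b :: real
    using that by linarith
  show "\<exists>L M. \<forall>e>0. \<exists>d>0.
     (\<forall>x y. 0 \<le> x \<and> x < y \<and> y \<le> 1 \<and> \<bar>x - a\<bar> < d \<and> \<bar>y - a\<bar> < d \<longrightarrow>
        \<bar>f y + g y - (f x + g x) - L * (y - x)\<bar> \<le> e * (y - x)) \<and>
     (\<forall>x t. 0 < t \<and> 0 \<le> x - t \<and> x + t \<le> 1 \<and> \<bar>x - t - a\<bar> < d \<and> \<bar>x + t - a\<bar> < d \<longrightarrow>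
        \<bar>f (x + t) + g (x + t) + (f (x - t) + g (x - t)) - 2 * (f x + g x) - M * t\<^sup>2\<bar> \<le> e * t\<^sup>2)"
  proof (rule exI[of _ "L + L'"], rule exI[of _ "M + M'"], intro allI impI)
    fix e :: real assume "e > 0"
    then have e: "e / 2 > 0" by simp
    from f[OF e] obtain d1 where d1: "d1 > 0"
      "\<And>x y. 0 \<le> x \<Longrightarrow> x < y \<Longrightarrow> y \<le> 1 \<Longrightarrow> \<bar>x - a\<bar> < d1 \<Longrightarrow> \<bar>y - a\<bar> < d1 \<Longrightarrow>
        \<bar>f y - f x - L * (y - x)\<bar> \<le> e / 2 * (y - x)"
      "\<And>x t. 0 < t \<Longrightarrow> 0 \<le> x - t \<Longrightarrow> x + t \<le> 1 \<Longrightarrow> \<bar>x - t - a\<bar> < d1 \<Longrightarrow> \<bar>x + t - a\<bar> < d1 \<Longrightarrow>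
        \<bar>f (x + t) + f (x - t) - 2 * f x - M * t\<^sup>2\<bar> \<le> e / 2 * t\<^sup>2" by blast
    from g[OF e] obtain d2 where d2: "d2 > 0"
      "\<And>x y. 0 \<le> x \<Longrightarrow> x < y \<Longrightarrow> y \<le> 1 \<Longrightarrow> \<bar>x - a\<bar> < d2 \<Longrightarrow> \<bar>y - a\<bar> < d2 \<Longrightarrow>
        \<bar>g y - g x - L' * (y - x)\<bar> \<le> e / 2 * (y - x)"
      "\<And>x t. 0 < t \<Longrightarrow> 0 \<le> x - t \<Longrightarrow> x + t \<le> 1 \<Longrightarrow> \<bar>x - t - a\<bar> < d2 \<Longrightarrow> \<bar>x + t - a\<bar> < d2 \<Longrightarrow>
        \<bar>g (x + t) + g (x - t) - 2 * g x - M' * t\<^sup>2\<bar> \<le> e / 2 * t\<^sup>2" by blast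
    define d where "d = min d1 d2"
    have d: "d > 0" "d \<le> d1" "d \<le> d2" using d1(1) d2(1) by (auto simp: d_def)
    have first: "\<bar>f y + g y - (f x + g x) - (L + L') * (y - x)\<bar> \<le> e * (y - x)"
      if xy: "0 \<le> x" "x < y" "y \<le> 1" "\<bar>x - a\<bar> < d" "\<bar>y - a\<bar> < d" for x y
      using triangle[of "f y - f x" "L * (y - x)" "e * (y - x)" "g y - g x" "L' * (y - x)"]
        d1(2)[of x y] d2(2)[of x y] xy d by (simp add: algebra_simps)
    have second: "\<bar>f (x + t) + g (x + t) + (f (x - t) + g (x - t)) - 2 * (f x + g x) - (M + M') * t\<^sup>2\<bar> \<le> e * t\<^sup>2"
      if xt: "0 < t" "0 \<le> x - t" "x + t \<le> 1" "\<bar>x - t - a\<bar> < d" "\<bar>x + t - a\<bar> < d" for x t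
      using triangle[of "f (x + t) + f (x - t) - 2 * f x" "M * t\<^sup>2" "e * t\<^sup>2" "g (x + t) + g (x - t) - 2 * g x" "M' * t\<^sup>2"]
        d1(3)[of t x] d2(3)[of t x] xt d by (simp add: algebra_simps)
    show "\<exists>d>0. (\<forall>x y. 0 \<le> x \<and> x < y \<and> y \<le> 1 \<and> \<bar>x - a\<bar> < d \<and> \<bar>y - a\<bar> < d \<longrightarrow>
        \<bar>f y + g y - (f x + g x) - (L + L') * (y - x)\<bar> \<le> e * (y - x)) \<and>
     (\<forall>x t. 0 < t \<and> 0 \<le> x - t \<and> x + t \<le> 1 \<and> \<bar>x - t - a\<bar> < d \<and> \<bar>x + t - a\<bar> < d \<longrightarrow>
        \<bar>f (x + t) + g (x + t) + (f (x - t) + g (x - t)) - 2 * (f x + g x) - (M + M') * t\<^sup>2\<bar> \<le> e * t\<^sup>2)"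
      using d(1) first second by blast
  qed
qed

lemma second_order_small_mono:
  assumes "second_order_small e f" "e \<le> e'"
  shows "second_order_small e' f"
proof -
  have "e * (y - x) \<le> e' * (y - x)" if "x < y" for x y
    using assms(2) that by (intro mult_right_mono) auto
  moreover have "e * t\<^sup>2 \<le> e' * t\<^sup>2" for t
    using assms(2) by (intro mult_right_mono) auto
  ultimately show ?thesis
    using assms unfolding second_order_small_def by (meson order_trans)
qed

lemma second_order_small_diagonal:
  assumes g: "Cr_differentiable_sq r g" and r: "2 \<le> r"
  shows "second_order_small (4 * Cr_norm_sq r g) (\<lambda>x. g (x, x))"
proof -
  let ?N = "Cr_norm_sq r g"
  have g2: "Cr_differentiable_sq 2 g" using Cr_differentiable_sq_antimono[OF g r] .
  have bound: "\<bar>g p\<bar> \<le> ?N" "\<bar>D1 g p\<bar> \<le> ?N" "\<bar>D2 g p\<bar> \<le> ?N" "\<bar>D1 (D1 g) p\<bar> \<le> ?N"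
    "\<bar>D2 (D1 g) p\<bar> \<le> ?N" "\<bar>D2 (D2 g) p\<bar> \<le> ?N" if "p \<in> unit_square" for p
  proof -
    have upper: "\<bar>(D2 ^^ j) ((D1 ^^ i) g) p\<bar> \<le> ?N" if "i + j \<le> 2" for i j
      using Cr_norm_sq_upper[OF g _ \<open>p \<in> unit_square\<close>] that r by simp
    show "\<bar>g p\<bar> \<le> ?N" "\<bar>D1 g p\<bar> \<le> ?N" "\<bar>D2 g p\<bar> \<le> ?N" "\<bar>D1 (D1 g) p\<bar> \<le> ?N"
      "\<bar>D2 (D1 g) p\<bar> \<le> ?N" "\<bar>D2 (D2 g) p\<bar> \<le> ?N"
      using upper[of 0 0] upper[of 1 0] upper[of 0 1] upper[of 2 0] upper[of 1 1] upper[of 0 2]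
      by (simp_all add: numeral_2_eq_2)
  qed
  have N: "0 \<le> ?N" using bound(1)[of "(0, 0)"] by simp
  show ?thesis
    unfolding second_order_small_def
  proof (intro conjI ballI allI impI; (elim conjE)?)
    fix x :: real assume "x \<in> {0..1}"
    then show "\<bar>g (x, x)\<bar> \<le> 4 * ?N" using bound(1)[of "(x, x)"] N by simp
  next
    fix x y :: real assume xy: "0 \<le> x" "x < y" "y \<le> 1"
    obtain \<xi> \<zeta> where m: "x < \<xi>" "\<xi> < y" "x < \<zeta>" "\<zeta> < y"
      "g (y, y) - g (x, x) = (D1 g (\<xi>, y) + D2 g (x, \<zeta>)) * (y - x)"
      using diagonal_difference_mean[OF g2 xy] by blast
    have "\<bar>D1 g (\<xi>, y) + D2 g (x, \<zeta>)\<bar> \<le> 4 * ?N"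
      using bound(2)[of "(\<xi>, y)"] bound(3)[of "(x, \<zeta>)"] m xy N by simp
    then have "\<bar>D1 g (\<xi>, y) + D2 g (x, \<zeta>)\<bar> * (y - x) \<le> 4 * ?N * (y - x)"
      using xy by (intro mult_right_mono) auto
    then show "\<bar>g (y, y) - g (x, x)\<bar> \<le> 4 * ?N * (y - x)" using xy by (simp add: m(5) abs_mult)
  next
    fix x t :: real assume xt: "0 < t" "0 \<le> x - t" "x + t \<le> 1"
    obtain p q v w where m: "p \<in> {x-t<..<x+t} \<times> {x-t<..<x+t}" "q \<in> {x-t<..<x+t} \<times> {x-t<..<x+t}"
      "v \<in> {x-t<..<x+t}" "w \<in> {x-t<..<x+t}"
      "g (x + t, x + t) + g (x - t, x - t) - 2 * g (x, x) =
         (D2 (D1 g) p + D2 (D1 g) q + D1 (D1 g) (v, x) + D2 (D2 g) (x, w)) * t\<^sup>2"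
      using diagonal_second_difference_mean[OF g2 xt] by blast
    have "p \<in> unit_square" "q \<in> unit_square" "(v, x) \<in> unit_square" "(x, w) \<in> unit_square"
      using m(1-4) xt by auto
    then have "\<bar>D2 (D1 g) p + D2 (D1 g) q + D1 (D1 g) (v, x) + D2 (D2 g) (x, w)\<bar> \<le> 4 * ?N"
      using bound(4)[of "(v, x)"] bound(5)[of p] bound(5)[of q] bound(6)[of "(x, w)"] by linarith
    then have "\<bar>D2 (D1 g) p + D2 (D1 g) q + D1 (D1 g) (v, x) + D2 (D2 g) (x, w)\<bar> * t\<^sup>2 \<le> 4 * ?N * t\<^sup>2"
      by (intro mult_right_mono) auto
    then show "\<bar>g (x + t, x + t) + g (x - t, x - t) - 2 * g (x, x)\<bar> \<le> 4 * ?N * t\<^sup>2"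
      by (simp add: m(5) abs_mult)
  qed
qed

lemma second_order_small_interval:
  assumes V: "Cr_differentiable_I r V" and r: "2 \<le> r"
  shows "second_order_small (Cr_norm_I r V) V"
proof -
  let ?N = "Cr_norm_I r V"
  have V2: "Cr_differentiable_I 2 V" using Cr_differentiable_I_antimono[OF V r] .
  have bound: "\<bar>V x\<bar> \<le> ?N" "\<bar>deriv_I V x\<bar> \<le> ?N" "\<bar>deriv_I (deriv_I V) x\<bar> \<le> ?N" if "x \<in> {0..1}" for x
    using Cr_norm_I_upper[OF V _ that, of 0] Cr_norm_I_upper[OF V _ that, of 1]
      Cr_norm_I_upper[OF V _ that, of 2] r
    by (simp_all add: numeral_2_eq_2)
  show ?thesis
    unfolding second_order_small_def
  proof (intro conjI ballI allI impI; (elim conjE)?)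
    fix x :: real assume "x \<in> {0..1}"
    then show "\<bar>V x\<bar> \<le> ?N" by (rule bound)
  next
    fix x y :: real assume xy: "0 \<le> x" "x < y" "y \<le> 1"
    obtain \<xi> where m: "x < \<xi>" "\<xi> < y" "V y - V x = deriv_I V \<xi> * (y - x)"
      using deriv_I_difference_mean[OF V2 xy] by blast
    have "\<bar>deriv_I V \<xi>\<bar> * (y - x) \<le> ?N * (y - x)"
      using xy m by (intro mult_right_mono bound) auto
    then show "\<bar>V y - V x\<bar> \<le> ?N * (y - x)" using xy by (simp add: m(3) abs_mult)
  next
    fix x t :: real assume xt: "0 < t" "0 \<le> x - t" "x + t \<le> 1"
    obtain z where m: "x - t < z" "z < x + t"
      "V (x + t) + V (x - t) - 2 * V x = deriv_I (deriv_I V) z * t\<^sup>2"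
      using deriv_I_second_difference_mean[OF V2 xt] by blast
    have "\<bar>deriv_I (deriv_I V) z\<bar> * t\<^sup>2 \<le> ?N * t\<^sup>2"
      using xt m by (intro mult_right_mono bound) auto
    then show "\<bar>V (x + t) + V (x - t) - 2 * V x\<bar> \<le> ?N * t\<^sup>2" by (simp add: m(3) abs_mult)
  qed
qed

section \<open>Norms of polynomial perturbations\<close>

lemma D1_funpow_poly:
  assumes "\<And>p. p \<in> unit_square \<Longrightarrow> f p = poly q (fst p)" "p \<in> unit_square"
  shows "(D1 ^^ i) f p = poly ((pderiv ^^ i) q) (fst p)"
  using assms(2)
proof (induction i arbitrary: p)
  case 0
  then show ?case using assms(1) by simp
next
  case (Suc i)
  obtain x y where p: "p = (x, y)" "x \<in> {0..1}" using Suc.prems by auto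
  have "D1 ((D1 ^^ i) f) p = D1 (\<lambda>p. poly ((pderiv ^^ i) q) (fst p)) p"
    by (rule D1_cong) (use Suc in auto)
  also have "\<dots> = poly (pderiv ((pderiv ^^ i) q)) (fst p)"
    unfolding p by (rule D1_eqI) (use p in \<open>auto intro: has_field_derivative_at_within poly_DERIV\<close>)
  finally show ?case by simp
qed

lemma D2_funpow_of_fst:
  assumes "\<And>p. p \<in> unit_square \<Longrightarrow> f p = k (fst p)" "p \<in> unit_square"
  shows "(D2 ^^ j) f p = (if j = 0 then k (fst p) else 0)"
  using assms(2)
proof (induction j arbitrary: p)
  case 0
  then show ?case using assms(1) by simp
next
  case (Suc j)
  obtain x y where p: "p = (x, y)" "y \<in> {0..1}" using Suc.prems by auto
  have "D2 ((D2 ^^ j) f) p = D2 (\<lambda>p. if j = 0 then k (fst p) else 0) p"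
    by (rule D2_cong) (use Suc in auto)
  also have "\<dots> = 0"
    unfolding p by (rule D2_eqI) (use p in \<open>simp_all only: fst_conv DERIV_const\<close>)
  finally show ?case by simp
qed

lemma deriv_I_funpow_poly:
  assumes "\<And>x. x \<in> {0..1} \<Longrightarrow> f x = poly q x" "x \<in> {0..1}"
  shows "(deriv_I ^^ i) f x = poly ((pderiv ^^ i) q) x"
  using assms(2)
proof (induction i arbitrary: x)
  case 0
  then show ?case using assms(1) by simp
next
  case (Suc i)
  have "deriv_I ((deriv_I ^^ i) f) x = deriv_I (poly ((pderiv ^^ i) q)) x"
    by (rule deriv_I_cong) (use Suc in auto)
  also have "\<dots> = poly (pderiv ((pderiv ^^ i) q)) x"
    by (rule deriv_I_eqI) (use Suc.prems in \<open>auto intro: has_field_derivative_at_within poly_DERIV\<close>)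
  finally show ?case by simp
qed

lemma Cr_differentiable_sq_poly: "Cr_differentiable_sq r (\<lambda>p. poly q (fst p))"
proof (induction r arbitrary: q)
  case 0
  show ?case by (auto intro!: continuous_intros)
next
  case (Suc r)
  let ?f = "\<lambda>p :: real \<times> real. poly q (fst p)"
  have D1: "D1 ?f p = poly (pderiv q) (fst p)" if "p \<in> unit_square" for p
    using D1_funpow_poly[of ?f q p 1] that by simp
  have D2: "D2 ?f p = poly 0 (fst p)" if "p \<in> unit_square" for p
    using D2_funpow_of_fst[of ?f "poly q" p 1] that by simp
  show ?case
  proof (rule Cr_differentiable_sq_SucI)
    fix x y :: real assume xy: "x \<in> {0..1}" "y \<in> {0..1}"
    then show "((\<lambda>t. ?f (t, y)) has_real_derivative D1 ?f (x, y)) (at x within {0..1})"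
      by (simp add: D1 has_field_derivative_at_within poly_DERIV)
    show "((\<lambda>t. ?f (x, t)) has_real_derivative D2 ?f (x, y)) (at y within {0..1})"
      using xy by (simp add: D2)
  next
    show "continuous_on unit_square ?f" by (auto intro!: continuous_intros)
    show "Cr_differentiable_sq r (D1 ?f)"
      by (rule Cr_differentiable_sq_cong[OF Suc.IH[of "pderiv q"]]) (simp add: D1)
    show "Cr_differentiable_sq r (D2 ?f)"
      by (rule Cr_differentiable_sq_cong[OF Suc.IH[of 0]]) (simp add: D2)
  qed
qed

lemma Cr_differentiable_I_poly: "Cr_differentiable_I r (poly q)"
proof (induction r arbitrary: q)
  case 0
  show ?case by (auto intro!: continuous_intros)
next
  case (Suc r)
  have D: "deriv_I (poly q) x = poly (pderiv q) x" if "x \<in> {0..1}" for x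
    using deriv_I_funpow_poly[of "poly q" q x 1] that by simp
  show ?case
  proof (rule Cr_differentiable_I_SucI)
    fix x :: real assume "x \<in> {0..1}"
    then show "(poly q has_real_derivative deriv_I (poly q) x) (at x within {0..1})"
      by (simp add: D has_field_derivative_at_within poly_DERIV)
  next
    show "continuous_on {0..1} (poly q)" by (auto intro!: continuous_intros)
    show "Cr_differentiable_I r (deriv_I (poly q))"
      by (rule Cr_differentiable_I_cong[OF Suc.IH[of "pderiv q"]]) (simp add: D)
  qed
qed

lemma pderiv_funpow_smult: "(pderiv ^^ i) (smult c q) = smult c ((pderiv ^^ i) q)"
  by (induction i) (simp_all add: pderiv_smult)

lemma iterated_pderiv_bounded:
  fixes q :: "real poly"
  obtains B where "\<And>i. B i \<ge> 0" "\<And>i x. x \<in> {0..1} \<Longrightarrow> \<bar>poly ((pderiv ^^ i) q) x\<bar> \<le> B i"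
proof -
  have "\<forall>i. \<exists>B. \<forall>x\<in>{0..1}. \<bar>poly ((pderiv ^^ i) q) x\<bar> \<le> B"
  proof
    fix i
    have "bounded (poly ((pderiv ^^ i) q) ` {0..1})"
      by (intro compact_imp_bounded compact_continuous_image) (auto intro!: continuous_intros)
    then show "\<exists>B. \<forall>x\<in>{0..1}. \<bar>poly ((pderiv ^^ i) q) x\<bar> \<le> B"
      unfolding bounded_iff by simp
  qed
  from choice[OF this] obtain B
    where B: "\<And>i x. x \<in> {0..1} \<Longrightarrow> \<bar>poly ((pderiv ^^ i) q) x\<bar> \<le> B i" by blast
  have "B i \<ge> 0" for i using B[of 0 i] by (intro order_trans[OF abs_ge_zero]) auto
  then show ?thesis using that B by blast
qed

text \<open>
  The bound on the norm of \<open>\<eta> q\<close> is stated for every function that agrees with it on the square, since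
  differences of extensional functions agree with a polynomial only there.
\<close>

lemma Cr_norm_sq_poly_le:
  obtains K where "\<And>\<eta> g. \<eta> \<ge> 0 \<Longrightarrow> (\<And>p. p \<in> unit_square \<Longrightarrow> g p = \<eta> * poly q (fst p)) \<Longrightarrow>
    Cr_norm_sq r g \<le> \<eta> * K"
proof -
  obtain B where B: "\<And>i. B i \<ge> 0" "\<And>i x. x \<in> {0..1} \<Longrightarrow> \<bar>poly ((pderiv ^^ i) q) x\<bar> \<le> B i"
    by (rule iterated_pderiv_bounded[where q = q]) blast
  show ?thesis
  proof (rule that[of "\<Sum>(i, j)\<in>{(i, j). i + j \<le> r}. B i"])
    fix \<eta> :: real and g :: "real \<times> real \<Rightarrow> real" assume \<eta>: "\<eta> \<ge> 0" and g: "\<And>p. p \<in> unit_square \<Longrightarrow> g p = \<eta> * poly q (fst p)"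
    have "\<bar>(D2 ^^ j) ((D1 ^^ i) g) p\<bar> \<le> \<eta> * B i" if p: "p \<in> unit_square" for i j p
    proof -
      have D1: "(D1 ^^ i) g p = poly ((pderiv ^^ i) (smult \<eta> q)) (fst p)" if "p \<in> unit_square" for p
        by (rule D1_funpow_poly[OF _ that]) (simp add: g)
      have "(D2 ^^ j) ((D1 ^^ i) g) p = (if j = 0 then poly ((pderiv ^^ i) (smult \<eta> q)) (fst p) else 0)"
        by (rule D2_funpow_of_fst[where k = "poly ((pderiv ^^ i) (smult \<eta> q))", OF D1 p])
      moreover have "\<bar>poly ((pderiv ^^ i) q) (fst p)\<bar> \<le> B i" using p by (intro B(2)) auto
      ultimately show ?thesis
        using \<eta> B(1)[of i] by (auto simp: pderiv_funpow_smult abs_mult intro: mult_left_mono)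
    qed
    then have "(SUP p\<in>unit_square. \<bar>(D2 ^^ j) ((D1 ^^ i) g) p\<bar>) \<le> \<eta> * B i" for i j
      by (intro cSUP_least) auto
    then show "Cr_norm_sq r g \<le> \<eta> * (\<Sum>(i, j)\<in>{(i, j). i + j \<le> r}. B i)"
      unfolding Cr_norm_sq_def sum_distrib_left by (intro sum_mono) auto
  qed
qed

lemma Cr_norm_I_poly_le:
  obtains K where "\<And>\<eta> g. \<eta> \<ge> 0 \<Longrightarrow> (\<And>x. x \<in> {0..1} \<Longrightarrow> g x = \<eta> * poly q x) \<Longrightarrow>
    Cr_norm_I r g \<le> \<eta> * K"
proof -
  obtain B where B: "\<And>i. B i \<ge> 0" "\<And>i x. x \<in> {0..1} \<Longrightarrow> \<bar>poly ((pderiv ^^ i) q) x\<bar> \<le> B i"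
    by (rule iterated_pderiv_bounded[where q = q]) blast
  show ?thesis
  proof (rule that[of "\<Sum>i\<le>r. B i"])
    fix \<eta> :: real and g :: "real \<Rightarrow> real" assume \<eta>: "\<eta> \<ge> 0" and g: "\<And>x. x \<in> {0..1} \<Longrightarrow> g x = \<eta> * poly q x"
    have "\<bar>(deriv_I ^^ i) g x\<bar> \<le> \<eta> * B i" if x: "x \<in> {0..1}" for i x
    proof -
      have "(deriv_I ^^ i) g x = poly ((pderiv ^^ i) (smult \<eta> q)) x"
        by (rule deriv_I_funpow_poly[OF _ x]) (simp add: g)
      then show ?thesis
        using \<eta> B(2)[OF x, of i] by (auto simp: pderiv_funpow_smult abs_mult intro: mult_left_mono)
    qed
    then have "(SUP x\<in>{0..1}. \<bar>(deriv_I ^^ i) g x\<bar>) \<le> \<eta> * B i" for i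
      by (intro cSUP_least) auto
    then show "Cr_norm_I r g \<le> \<eta> * (\<Sum>i\<le>r. B i)"
      unfolding Cr_norm_I_def sum_distrib_left by (intro sum_mono) auto
  qed
qed

section \<open>Generic uniqueness of the minimum\<close>

lemma open_dense_norm_topologyI:
  assumes "U \<subseteq> F" "A \<subseteq> F"
    and "\<And>f. f \<in> U \<Longrightarrow> \<exists>\<epsilon>>0. \<forall>g\<in>F. N (\<lambda>p. g p - f p) < \<epsilon> \<longrightarrow> g \<in> U"
    and dense: "\<And>f \<epsilon>. f \<in> A \<Longrightarrow> \<epsilon> > 0 \<Longrightarrow> \<exists>g\<in>A \<inter> U. N (\<lambda>p. g p - f p) < \<epsilon>"
  shows "open_dense_in (subtopology (norm_topology F N) A) (A \<inter> U)"
  unfolding open_dense_in_def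
proof
  have "openin (norm_topology F N) U"
    using assms(1,3) by (simp add: openin_norm_topology)
  then show "openin (subtopology (norm_topology F N) A) (A \<inter> U)"
    by (auto simp: openin_subtopology)
  have top: "topspace (subtopology (norm_topology F N) A) = A" using assms(2) by auto
  have "f \<in> subtopology (norm_topology F N) A closure_of (A \<inter> U)" if f: "f \<in> A" for f
    unfolding in_closure_of top
  proof (intro conjI allI impI f)
    fix T assume "f \<in> T \<and> openin (subtopology (norm_topology F N) A) T"
    then obtain T' where T': "openin (norm_topology F N) T'" "T = T' \<inter> A" "f \<in> T'"
      by (auto simp: openin_subtopology)
    then obtain \<epsilon> where \<epsilon>: "\<epsilon> > 0" "\<And>g. g \<in> F \<Longrightarrow> N (\<lambda>p. g p - f p) < \<epsilon> \<Longrightarrow> g \<in> T'"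
      unfolding openin_norm_topology by blast
    obtain g where "g \<in> A \<inter> U" "N (\<lambda>p. g p - f p) < \<epsilon>" using dense[OF f \<epsilon>(1)] by blast
    then show "\<exists>g. g \<in> A \<inter> U \<and> g \<in> T" using \<epsilon>(2) T'(2) assms(2) by blast
  qed
  then have "topspace (subtopology (norm_topology F N) A) \<subseteq> subtopology (norm_topology F N) A closure_of (A \<inter> U)"
    unfolding top by (rule subsetI)
  with closure_of_subset_topspace
  show "subtopology (norm_topology F N) A closure_of (A \<inter> U) = topspace (subtopology (norm_topology F N) A)"
    by (rule equalityI)
qed

lemma small_multiple:
  fixes K \<epsilon> :: real
  assumes "\<epsilon> > 0"
  obtains \<eta> where "\<eta> > 0" "\<eta> * K < \<epsilon>"
proof (rule that[of "\<epsilon> / (\<bar>K\<bar> + 1)"])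
  show \<eta>: "\<epsilon> / (\<bar>K\<bar> + 1) > 0" using assms by simp
  then have "\<epsilon> / (\<bar>K\<bar> + 1) * K < \<epsilon> / (\<bar>K\<bar> + 1) * (\<bar>K\<bar> + 1)"
    by (intro mult_strict_left_mono) auto
  also have "\<dots> = \<epsilon>" by simp
  finally show "\<epsilon> / (\<bar>K\<bar> + 1) * K < \<epsilon>" .
qed

text \<open>
  The perturbation depends on the first variable only, so it does not affect \<open>D2 (D1 h)\<close> and stays in
  the twist class.
\<close>

lemma open_dense_nondegenerate_diagonal:
  assumes "r \<ge> 2"
  shows "open_dense_in (subtopology (Cr_topology_sq r) (twist_class r))
    (twist_class r \<inter> {h \<in> Cr_sq r. nondegenerate_min (\<lambda>x. h (x, x))})"
    (is "open_dense_in _ (_ \<inter> ?U)")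
  unfolding Cr_topology_sq_def
proof (rule open_dense_norm_topologyI)
  show "?U \<subseteq> Cr_sq r" "twist_class r \<subseteq> Cr_sq r" by (auto simp: twist_class_def)
next
  fix h assume h: "h \<in> ?U"
  then obtain e where e: "e > 0"
    "\<And>g. second_order_small e g \<Longrightarrow> nondegenerate_min (\<lambda>x. h (x, x) + g x)"
    using nondegenerate_min_stable by blast
  have "g \<in> ?U" if g: "g \<in> Cr_sq r" "Cr_norm_sq r (\<lambda>p. g p - h p) < e / 4" for g
  proof -
    have "Cr_differentiable_sq r (\<lambda>p. g p + - 1 * h p)"
      using g h by (intro Cr_differentiable_sq_linear) (auto simp: Cr_sq_def)
    then have "second_order_small (4 * Cr_norm_sq r (\<lambda>p. g p - h p)) (\<lambda>x. g (x, x) - h (x, x))"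
      using second_order_small_diagonal[OF _ assms, of "\<lambda>p. g p - h p"] by simp
    then have "second_order_small e (\<lambda>x. g (x, x) - h (x, x))"
      by (rule second_order_small_mono) (use g(2) in simp)
    from e(2)[OF this] show ?thesis using g(1) by simp
  qed
  then show "\<exists>\<epsilon>>0. \<forall>g\<in>Cr_sq r. Cr_norm_sq r (\<lambda>p. g p - h p) < \<epsilon> \<longrightarrow> g \<in> ?U"
    using e(1) by (intro exI[of _ "e / 4"]) auto
next
  fix h :: "real \<times> real \<Rightarrow> real" and \<epsilon> :: real assume h: "h \<in> twist_class r" and \<epsilon>: "\<epsilon> > 0"
  have hr: "Cr_differentiable_sq r h" using h by (simp add: twist_class_def Cr_sq_def)
  have h2: "Cr_differentiable_sq 2 h" using Cr_differentiable_sq_antimono[OF hr assms] .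
  then have hc: "continuous_on unit_square h" by (simp add: numeral_2_eq_2)
  have "continuous_on {0..1} (\<lambda>x. h (x, x))"
    by (rule continuous_on_compose2[OF hc]) (auto intro!: continuous_intros)
  then obtain a where a: "a \<in> {0..1}" "\<And>x. x \<in> {0..1} \<Longrightarrow> h (a, a) \<le> h (x, x)"
    using continuous_attains_inf[of "{0..1}" "\<lambda>x. h (x, x)"] by auto
  obtain q where q: "\<And>\<eta>. \<eta> > 0 \<Longrightarrow> nondegenerate_min (\<lambda>x. h (x, x) + \<eta> * poly q x)"
    using nondegenerate_min_perturbation[OF second_order_regular_diagonal[OF h2] a] by blast
  obtain K where K: "\<And>\<eta> g. \<eta> \<ge> 0 \<Longrightarrow> (\<And>p. p \<in> unit_square \<Longrightarrow> g p = \<eta> * poly q (fst p)) \<Longrightarrow>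
      Cr_norm_sq r g \<le> \<eta> * K"
    using Cr_norm_sq_poly_le by blast
  obtain \<eta> where \<eta>: "\<eta> > 0" "\<eta> * K < \<epsilon>" using small_multiple[OF \<epsilon>] by blast
  define g where "g = restrict (\<lambda>p. h p + \<eta> * poly q (fst p)) unit_square"
  have gp: "h p + \<eta> * poly q (fst p) = g p" if "p \<in> unit_square" for p
    using that by (simp add: g_def)
  have lin: "Cr_differentiable_sq r (\<lambda>p. h p + \<eta> * poly q (fst p))"
    by (intro Cr_differentiable_sq_linear hr Cr_differentiable_sq_poly)
  then have "Cr_differentiable_sq r g"
    by (rule Cr_differentiable_sq_cong) (rule gp)
  then have g: "g \<in> Cr_sq r" by (simp add: Cr_sq_def g_def)
  have "D2 (D1 g) p < 0" if p: "p \<in> unit_square" for p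
  proof -
    have h1: "Cr_differentiable_sq (Suc 1) h" "Cr_differentiable_sq (Suc 0) (D1 h)"
      using h2 by (simp_all add: numeral_2_eq_2)
    let ?q = "\<lambda>p :: real \<times> real. poly q (fst p)"
    have q1: "Cr_differentiable_sq (Suc 1) ?q" by (rule Cr_differentiable_sq_poly)
    then have q2: "Cr_differentiable_sq (Suc 0) (D1 ?q)" by simp
    have D1g: "D1 g p = D1 h p + \<eta> * D1 ?q p" if "p \<in> unit_square" for p
      using D1_cong[of "\<lambda>p. h p + \<eta> * ?q p" g p] gp D1_linear[OF h1(1) q1 that] that by simp
    have "D2 (D1 g) p = D2 (\<lambda>p. D1 h p + \<eta> * D1 ?q p) p" by (rule D2_cong[OF D1g p])
    also have "\<dots> = D2 (D1 h) p + \<eta> * D2 (D1 ?q) p" by (rule D2_linear[OF h1(2) q2 p])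
    also have "D2 (D1 ?q) p = 0"
      using D2_funpow_of_fst[of "D1 ?q" "poly (pderiv q)" p 1] D1_funpow_poly[of ?q q _ 1] p by simp
    finally have "D2 (D1 g) p = D2 (D1 h) p" by simp
    moreover have "D2 (D1 h) p < 0" using h p unfolding twist_class_def by blast
    ultimately show ?thesis by simp
  qed
  then have gt: "g \<in> twist_class r" using g by (simp add: twist_class_def)
  have "nondegenerate_min (\<lambda>x. g (x, x))"
    by (rule nondegenerate_min_cong[OF q[OF \<eta>(1)]]) (use gp in force)
  moreover have "Cr_norm_sq r (\<lambda>p. g p - h p) \<le> \<eta> * K"
    by (rule K) (use \<eta> gp[symmetric] in auto)
  ultimately show "\<exists>g\<in>twist_class r \<inter> ?U. Cr_norm_sq r (\<lambda>p. g p - h p) < \<epsilon>"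
    using gt g \<eta>(2) by (intro bexI[of _ g]) auto
qed

lemma open_dense_nondegenerate_potential:
  assumes "r \<ge> 2" and h: "h \<in> twist_class r"
  shows "open_dense_in (Cr_topology_I r) {V \<in> Cr_I r. nondegenerate_min (\<lambda>x. h (x, x) + V x)}"
    (is "open_dense_in _ ?U")
proof -
  have hr: "Cr_differentiable_sq r h" using h by (simp add: twist_class_def Cr_sq_def)
  have h2: "Cr_differentiable_sq 2 h" using Cr_differentiable_sq_antimono[OF hr assms(1)] .
  then have hc: "continuous_on unit_square h" by (simp add: numeral_2_eq_2)
  have diag_c: "continuous_on {0..1} (\<lambda>x. h (x, x))"
    by (rule continuous_on_compose2[OF hc]) (auto intro!: continuous_intros)
  have "open_dense_in (subtopology (norm_topology (Cr_I r) (Cr_norm_I r)) (Cr_I r)) (Cr_I r \<inter> ?U)"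
  proof (rule open_dense_norm_topologyI)
    show "?U \<subseteq> Cr_I r" "Cr_I r \<subseteq> Cr_I r" by auto
  next
    fix V assume V: "V \<in> ?U"
    then obtain e where e: "e > 0"
      "\<And>g. second_order_small e g \<Longrightarrow> nondegenerate_min (\<lambda>x. (h (x, x) + V x) + g x)"
      using nondegenerate_min_stable by blast
    have "W \<in> ?U" if W: "W \<in> Cr_I r" "Cr_norm_I r (\<lambda>x. W x - V x) < e" for W
    proof -
      have "Cr_differentiable_I r (\<lambda>x. W x + - 1 * V x)"
        using W V by (intro Cr_differentiable_I_linear) (auto simp: Cr_I_def)
      then have "second_order_small (Cr_norm_I r (\<lambda>x. W x - V x)) (\<lambda>x. W x - V x)"
        using second_order_small_interval[OF _ assms(1), of "\<lambda>x. W x - V x"] by simp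
      then have "second_order_small e (\<lambda>x. W x - V x)"
        by (rule second_order_small_mono) (use W(2) in simp)
      from e(2)[OF this] show ?thesis using W(1) by simp
    qed
    then show "\<exists>\<epsilon>>0. \<forall>W\<in>Cr_I r. Cr_norm_I r (\<lambda>x. W x - V x) < \<epsilon> \<longrightarrow> W \<in> ?U"
      using e(1) by (intro exI[of _ e]) auto
  next
    fix V :: "real \<Rightarrow> real" and \<epsilon> :: real assume V: "V \<in> Cr_I r" and \<epsilon>: "\<epsilon> > 0"
    have Vr: "Cr_differentiable_I r V" using V by (simp add: Cr_I_def)
    have V2: "Cr_differentiable_I 2 V" using Cr_differentiable_I_antimono[OF Vr assms(1)] .
    then have Vc: "continuous_on {0..1} V" by (simp add: numeral_2_eq_2)
    obtain a where a: "a \<in> {0..1}" "\<And>x. x \<in> {0..1} \<Longrightarrow> h (a, a) + V a \<le> h (x, x) + V x"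
      using continuous_attains_inf[of "{0..1}" "\<lambda>x. h (x, x) + V x"] continuous_on_add[OF diag_c Vc] by auto
    obtain q where q: "\<And>\<eta>. \<eta> > 0 \<Longrightarrow> nondegenerate_min (\<lambda>x. h (x, x) + V x + \<eta> * poly q x)"
      using nondegenerate_min_perturbation[OF second_order_regular_add[OF
          second_order_regular_diagonal[OF h2] second_order_regular_interval[OF V2]] a] by blast
    obtain K where K: "\<And>\<eta> g. \<eta> \<ge> 0 \<Longrightarrow> (\<And>x. x \<in> {0..1} \<Longrightarrow> g x = \<eta> * poly q x) \<Longrightarrow>
        Cr_norm_I r g \<le> \<eta> * K"
      using Cr_norm_I_poly_le by blast
    obtain \<eta> where \<eta>: "\<eta> > 0" "\<eta> * K < \<epsilon>" using small_multiple[OF \<epsilon>] by blast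
    define W where "W = restrict (\<lambda>x. V x + \<eta> * poly q x) {0..1}"
    have Wx: "V x + \<eta> * poly q x = W x" if "x \<in> {0..1}" for x
      using that by (simp add: W_def)
    have "Cr_differentiable_I r (\<lambda>x. V x + \<eta> * poly q x)"
      by (intro Cr_differentiable_I_linear Vr Cr_differentiable_I_poly)
    then have "Cr_differentiable_I r W"
      by (rule Cr_differentiable_I_cong) (rule Wx)
    then have W: "W \<in> Cr_I r" by (simp add: Cr_I_def W_def)
    have "nondegenerate_min (\<lambda>x. h (x, x) + W x)"
      by (rule nondegenerate_min_cong[OF q[OF \<eta>(1)]]) (use Wx in force)
    moreover have "Cr_norm_I r (\<lambda>x. W x - V x) \<le> \<eta> * K"
      by (rule K) (use \<eta> Wx[symmetric] in auto)
    ultimately show "\<exists>W\<in>Cr_I r \<inter> ?U. Cr_norm_I r (\<lambda>x. W x - V x) < \<epsilon>"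
      using W \<eta>(2) by (intro bexI[of _ W]) auto
  qed
  moreover have "Cr_I r \<inter> ?U = ?U" by blast
  ultimately show ?thesis
    using subtopology_topspace[of "norm_topology (Cr_I r) (Cr_norm_I r)"]
    by (simp add: Cr_topology_I_def)
qed

section \<open>Generic twist potentials\<close>

text \<open>
  Adding \<open>V (x 0)\<close> changes both sides of the sub-action inequality of \<open>h\<close> by the same amount.
\<close>

lemma twist_unique_minimum_fixed_point:
  assumes h: "h \<in> twist_class r" and r: "r \<ge> 2" and V: "continuous_on {0..1} V"
    and nondeg: "nondegenerate_min (\<lambda>x. h (x, x) + V x)"
  shows "\<exists>p\<in>xy_space. left_shift p = p \<and>
    mather_set (\<lambda>x. h (x 0, x 1) + V (x 0)) = {p} \<and> aubry_set (\<lambda>x. h (x 0, x 1) + V (x 0)) = {p}"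
proof -
  have h2: "Cr_differentiable_sq 2 h"
    using h r Cr_differentiable_sq_antimono by (auto simp: twist_class_def Cr_sq_def)
  then have hc: "continuous_on unit_square h" by (simp add: numeral_2_eq_2)
  have twist: "\<And>p. p \<in> unit_square \<Longrightarrow> D2 (D1 h) p < 0" using h unfolding twist_class_def by blast
  obtain u where u: "continuous_on {0..1} u"
    "\<And>x y. x \<in> {0..1} \<Longrightarrow> y \<in> {0..1} \<Longrightarrow> h (x, x) + u y - u x \<le> h (x, y)"
    using twist_subaction[OF h2 twist] by blast
  have "continuous_on {0..1} (\<lambda>x. h (x, x) + V x)"
    by (intro continuous_on_add V continuous_on_compose2[OF hc]) (auto intro!: continuous_intros)
  then obtain a where a: "a \<in> {0..1}" "\<And>x. x \<in> {0..1} \<Longrightarrow> x \<noteq> a \<Longrightarrow> h (a, a) + V a < h (x, x) + V x"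
    using nondegenerate_min_unique[OF nondeg] by blast
  interpret diagonal_minimum "\<lambda>p. h p + V (fst p)" u a
  proof
    show "continuous_on unit_square (\<lambda>p. h p + V (fst p))"
      by (intro continuous_on_add hc continuous_on_compose2[OF V]) (auto intro!: continuous_intros)
    show "h (x, x) + V (fst (x, x)) + u y - u x \<le> h (x, y) + V (fst (x, y))"
      if "x \<in> {0..1}" "y \<in> {0..1}" for x y
      using u(2)[OF that] by simp
  qed (use u(1) a in auto)
  show ?thesis
    using fixpt mather_set_eq aubry_set_eq by (intro bexI[of _ "\<lambda>_. a"]) simp_all
qed

theorem theorem4:
  fixes r :: nat
  assumes "r \<ge> 2"
  shows "(\<exists>\<O>. open_dense_in (subtopology (Cr_topology_sq r) (twist_class r)) \<O> \<and>
           (\<forall>h\<in>\<O>. \<exists>p\<in>xy_space. left_shift p = p \<and>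
              mather_set (\<lambda>x. h (x 0, x 1)) = {p} \<and>
              aubry_set (\<lambda>x. h (x 0, x 1)) = {p})) \<and>
         (\<forall>h\<in>twist_class r. \<exists>\<V>. open_dense_in (Cr_topology_I r) \<V> \<and>
           (\<forall>V\<in>\<V>. \<exists>p\<in>xy_space. left_shift p = p \<and>
              mather_set (\<lambda>x. h (x 0, x 1) + V (x 0)) = {p} \<and>
              aubry_set (\<lambda>x. h (x 0, x 1) + V (x 0)) = {p}))"
proof (intro conjI ballI)
  have "\<exists>p\<in>xy_space. left_shift p = p \<and> mather_set (\<lambda>x. h (x 0, x 1)) = {p} \<and>
      aubry_set (\<lambda>x. h (x 0, x 1)) = {p}"
    if "h \<in> twist_class r \<inter> {h \<in> Cr_sq r. nondegenerate_min (\<lambda>x. h (x, x))}" for h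
    using twist_unique_minimum_fixed_point[of h r "\<lambda>_. 0"] that assms by simp
  then show "\<exists>\<O>. open_dense_in (subtopology (Cr_topology_sq r) (twist_class r)) \<O> \<and>
           (\<forall>h\<in>\<O>. \<exists>p\<in>xy_space. left_shift p = p \<and>
              mather_set (\<lambda>x. h (x 0, x 1)) = {p} \<and>
              aubry_set (\<lambda>x. h (x 0, x 1)) = {p})"
    using open_dense_nondegenerate_diagonal[OF assms] by blast
next
  fix h assume h: "h \<in> twist_class r"
  have "\<exists>p\<in>xy_space. left_shift p = p \<and>
      mather_set (\<lambda>x. h (x 0, x 1) + V (x 0)) = {p} \<and>
      aubry_set (\<lambda>x. h (x 0, x 1) + V (x 0)) = {p}"
    if "V \<in> {V \<in> Cr_I r. nondegenerate_min (\<lambda>x. h (x, x) + V x)}" for V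
  proof -
    have "Cr_differentiable_I 0 V"
      using that Cr_differentiable_I_antimono[of r V 0] by (simp add: Cr_I_def)
    then show ?thesis using twist_unique_minimum_fixed_point[OF h assms] that by simp
  qed
  then show "\<exists>\<V>. open_dense_in (Cr_topology_I r) \<V> \<and>
           (\<forall>V\<in>\<V>. \<exists>p\<in>xy_space. left_shift p = p \<and>
              mather_set (\<lambda>x. h (x 0, x 1) + V (x 0)) = {p} \<and>
              aubry_set (\<lambda>x. h (x 0, x 1) + V (x 0)) = {p})"
    using open_dense_nondegenerate_potential[OF assms h] by blast
qed

end
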